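(* Let $m\ge n$ be positive integers. The map $\Psi_0:\mathrm{Ev}_0(n,m)\to\mathrm{Pr}_0(n,m)$ defined by $\Psi_0(\mathrm{ev}_{\underline\alpha}):=\pi_{\Psi(\underline\alpha)}$ is a surjective group homomorphism with kernel $$\ker\Psi_0=\{\mathrm{ev}_{\underline\alpha}\mid\underline\alpha\in I(n,m)\text{ and }\alpha_{i,j}=1\text{ for all }i\le j\}.$$ Consequently $\mathcal{M}_{ord}(n,m)\cong\mathrm{Ev}_0(n,m)/\ker\Psi_0$.
   Context: Let $\mathbb{K}$ be an algebraically closed field of characteristic zero. A semistandard Young tableau of partition shape $\lambda$ is a filling of the Ferrers diagram of $\lambda$ (English notation) with positive integers, strictly increasing down columns and weakly increasing from left to right along rows. For positive integers $m\ge n$, $\mathrm{SSYT}_m^n$ denotes the set of all semistandard Young tableaux of all partition shapes with at most $n$ rows and with entries in $\{1,\dots,m\}$ (including the empty tableau $\emptyset$). For $T$ of shape $\lambda$ and $T'$ of shape $\mu$, $T\star T'$ is the semistandard Young tableau of shape $\lambda+\mu$ obtained by horizontally concatenating the rows of $T$ and $T'$ and sorting the entries in each row in weakly increasing order. $(\mathrm{SSYT}_m^n,\star,\emptyset)$ is a commutative monoid, and the tableaux algebra $\mathcal{T}_{n,m}$ is its monoid algebra over $\mathbb{K}$. Let $G_{n,m}=\{T_1,\dots,T_d\}$ be the set of tableaux in $\mathrm{SSYT}_m^n$ with exactly one column (of height $1,\dots,n$). Write $[a_1,\dots,a_k]$ for the column with entries $a_1<\dots<a_k$ from top to bottom. Set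 $F_{n,n}=\{[n],\,[1,\dots,n-1],\,[1,\dots,n]\}$ (for $n=1$ this is just $\{[1]\}$), $F_{n,m}=\{[m],\,[1,\dots,n]\}$ if $m\ne n$, and $E_{n,m}=G_{n,m}\setminus F_{n,m}$. A product relation is a binomial $T_aT_b-T_cT_e$ with $T_a,T_b,T_c,T_e\in G_{n,m}$ distinct and $T_a\star T_b=T_c\star T_e$; all product relations involve only variables in $E_{n,m}$, and $\mathcal{P}_{n,m}$ is the ideal they generate in the polynomial ring $\mathbb{K}[E_{n,m}]$, with zero locus $\mathcal{V}(\mathcal{P}_{n,m})\subseteq\mathbb{K}^{|E_{n,m}|}$. For $\underline t=(t_i)_{1\le i\le d}\in\mathcal{V}(\mathcal{P}_{n,m})\times\mathbb{K}^{|F_{n,m}|}$ (coordinates indexed by $G_{n,m}$), $M_{\underline t}$ is the maximal ideal of $\mathcal{T}_{n,m}$ generated by all $T_i-t_i$, and $\pi_{\underline t}:\mathcal{T}_{n,m}\to\mathcal{T}_{n,m}/M_{\underline t}\cong\mathbb{K}$ is the quotient map, $T_i\mapsto t_i$. Let $J(n,m)$ be the set of such $\underline t$ with $t_i\ne0$ for all $i$. Put $\mathcal{M}_{ord}(n,m)=\{M_{\underline t}:\underline t\in J(n,m)\}$ and $\mathrm{Pr}_0(n,m)=\{\pi_{\underline t}:\underline t\in J(n,m)\}$; these are commutative groups under $M_{\underline t}\circledast M_{\underline s}:=M_{\underline t\,\underline s}$ and $\pi_{\underline t}\circledast\pi_{\underline s}:=\pi_{\underline t\,\underline s}$, where $\underline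 t\,\underline s$ is the entrywise product. Let $X=\{x^{(i)}_j:1\le i\le n,1\le j\le m\}$ be commuting variables. For $\underline\alpha=(\alpha_{i,j})\in\mathbb{K}^{nm}$ let $\mathrm{ev}_{\underline\alpha}:\mathbb{K}[X]\to\mathbb{K}$ be the algebra homomorphism $x_j^{(i)}\mapsto\alpha_{i,j}$. Let $I(n,m)=\{\underline\alpha\in\mathbb{K}^{nm}:\alpha_{i,j}\ne0\text{ for all }1\le i\le n,\,1\le j\le m\}$ and $\mathrm{Ev}_0(n,m)=\{\mathrm{ev}_{\underline\alpha}:\underline\alpha\in I(n,m)\}$, a commutative group under $\mathrm{ev}_{\underline\alpha}\circledast\mathrm{ev}_{\underline\beta}:=\mathrm{ev}_{\underline{\alpha\beta}}$ (entrywise product). Let $\widetilde{\mathrm{ev}}_{\underline\alpha}:\mathcal{T}_{n,m}\to\mathbb{K}$ be the algebra homomorphism given on tableaux by $T\mapsto\prod_{i,j}\alpha_{i,j}^{\mathrm{wt}^{(i)}_j(T)}$, where $\mathrm{wt}_j^{(i)}(T)$ is the number of $j$'s in row $i$ of $T$, and let $\Psi(\underline\alpha)=(\widetilde{\mathrm{ev}}_{\underline\alpha}(T_1),\dots,\widetilde{\mathrm{ev}}_{\underline\alpha}(T_d))$, which lies in $\mathcal{V}(\mathcal{P}_{n,m})\times\mathbb{K}^{|F_{n,m}|}$. *)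

theory Defs
  imports
    "HOL-Algebra.QuotRing"
    "HOL-Algebra.Coset"
    "HOL-Library.Poly_Mapping"
    "HOL-Computational_Algebra.Polynomial"
begin

text \<open>A tableau is stored as the list of its (nonempty) rows from top to bottom.\<close>

definition column_strict :: "nat list \<Rightarrow> nat list \<Rightarrow> bool" where
  "column_strict r s \<longleftrightarrow> length s \<le> length r \<and> (\<forall>j<length s. r ! j < s ! j)"

definition semistandard :: "nat list list \<Rightarrow> bool" where
  "semistandard rs \<longleftrightarrow>
     (\<forall>r\<in>set rs. r \<noteq> [] \<and> sorted r \<and> 0 \<notin> set r) \<and> successively column_strict rs"

typedef tableau = "{rs. semistandard rs}" morphisms rows Tableau
  by (rule exI[of _ "[]"]) (simp add: semistandard_def)

setup_lifting type_definition_tableau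

text \<open>Rows beyond the last row of one factor are already sorted and are copied unchanged.\<close>

fun star_rows :: "nat list list \<Rightarrow> nat list list \<Rightarrow> nat list list" where
  "star_rows [] S = S"
| "star_rows R [] = R"
| "star_rows (r # R) (s # S) = sort (r @ s) # star_rows R S"

lemma star_rows_Nil2 [simp]: "star_rows R [] = R"
  by (cases R) auto

lemma column_strict_iff_count:
  assumes "sorted r" "sorted s"
  shows "column_strict r s \<longleftrightarrow>
    (\<forall>v. length (filter (\<lambda>x. x \<le> v) s) \<le> length (filter (\<lambda>x. x < v) r))"
proof
  assume cs: "column_strict r s"
  show "\<forall>v. length (filter (\<lambda>x. x \<le> v) s) \<le> length (filter (\<lambda>x. x < v) r)"
  proof
    fix v
    define k where "k = length (takeWhile (\<lambda>x. x \<le> v) s)"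
    have f: "filter (\<lambda>x. x \<le> v) s = takeWhile (\<lambda>x. x \<le> v) s"
      using assms(2)
    proof (induction s)
      case (Cons a s)
      show ?case
      proof (cases "a \<le> v")
        case True
        then show ?thesis using Cons by simp
      next
        case False
        then have "\<forall>x\<in>set s. \<not> x \<le> v" using Cons.prems by fastforce
        then show ?thesis using False by (simp add: filter_empty_conv)
      qed
    qed simp
    have ks: "k \<le> length s" unfolding k_def by (rule length_takeWhile_le)
    have kr: "k \<le> length r" using ks cs by (auto simp: column_strict_def)
    have "r ! j < v" if "j < k" for j
    proof -
      have "s ! j \<le> v"
        using that set_takeWhileD[of "s ! j" "\<lambda>x. x \<le> v" s]
          nth_mem[of j "takeWhile (\<lambda>x. x \<le> v) s"]
        by (simp add: k_def takeWhile_nth)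
      moreover have "r ! j < s ! j" using that ks cs by (auto simp: column_strict_def)
      ultimately show ?thesis by simp
    qed
    then have "\<forall>x\<in>set (take k r). x < v"
      by (auto simp: in_set_conv_nth)
    then have "filter (\<lambda>x. x < v) (take k r) = take k r"
      by (simp add: filter_id_conv)
    then have "k \<le> length (filter (\<lambda>x. x < v) (take k r @ drop k r))"
      unfolding filter_append using kr by simp
    then show "length (filter (\<lambda>x. x \<le> v) s) \<le> length (filter (\<lambda>x. x < v) r)"
      by (simp add: f k_def)
  qed
next
  assume c: "\<forall>v. length (filter (\<lambda>x. x \<le> v) s) \<le> length (filter (\<lambda>x. x < v) r)"
  have "length s \<le> length r"
  proof (cases "s = []")
    case False
    have "filter (\<lambda>x. x \<le> Max (set s)) s = s"
      by (simp add: filter_id_conv)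
    then have "length s \<le> length (filter (\<lambda>x. x < Max (set s)) r)"
      using c[rule_format, of "Max (set s)"] by simp
    then show ?thesis using length_filter_le le_trans by blast
  qed simp
  moreover have "r ! j < s ! j" if j: "j < length s" for j
  proof (rule ccontr)
    assume n: "\<not> r ! j < s ! j"
    have "\<forall>x\<in>set (take (Suc j) s). x \<le> s ! j"
      using j assms(2) by (auto simp: in_set_conv_nth less_Suc_eq_le sorted_iff_nth_mono)
    then have "filter (\<lambda>x. x \<le> s ! j) (take (Suc j) s) = take (Suc j) s"
      by (simp add: filter_id_conv)
    then have "Suc j \<le> length (filter (\<lambda>x. x \<le> s ! j) (take (Suc j) s @ drop (Suc j) s))"
      unfolding filter_append using j by simp
    then have 1: "Suc j \<le> length (filter (\<lambda>x. x < s ! j) r)"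
      using c[rule_format, of "s ! j"] by simp
    have "\<forall>x\<in>set (drop j r). \<not> x < s ! j"
    proof
      fix x assume "x \<in> set (drop j r)"
      then obtain i where "i < length r - j" "x = r ! (j + i)"
        by (auto simp: in_set_conv_nth)
      then have "r ! j \<le> x" using assms(1) by (auto intro!: sorted_nth_mono)
      then show "\<not> x < s ! j" using n by simp
    qed
    then have "filter (\<lambda>x. x < s ! j) (drop j r) = []"
      by (simp add: filter_empty_conv)
    then have "length (filter (\<lambda>x. x < s ! j) (take j r @ drop j r)) \<le> j"
      unfolding filter_append using length_filter_le[of "\<lambda>x. x < s ! j" "take j r"] by simp
    then show False using 1 by simp
  qed
  ultimately show "column_strict r s" by (simp add: column_strict_def)
qed

lemma length_filter_sort: "length (filter P (sort xs)) = length (filter P xs)"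
  by (metis mset_filter mset_sort size_mset)

lemma column_strict_sort_append:
  assumes "sorted r" "sorted s" "sorted r'" "sorted s'"
    and "column_strict r r'" "column_strict s s'"
  shows "column_strict (sort (r @ s)) (sort (r' @ s'))"
  using assms
  by (simp add: column_strict_iff_count length_filter_sort add_mono)

lemma column_strict_Nil [simp]: "column_strict r []"
  by (simp add: column_strict_def)

lemma column_strict_sort1:
  assumes "sorted r" "sorted s" "sorted r'" "column_strict r r'"
  shows "column_strict (sort (r @ s)) r'"
  using column_strict_sort_append[of r s r' "[]"] assms by (simp add: sorted_sort_id)

lemma column_strict_sort2:
  assumes "sorted r" "sorted s" "sorted s'" "column_strict s s'"
  shows "column_strict (sort (r @ s)) s'"
  using column_strict_sort_append[of r s "[]" s'] assms by (simp add: sorted_sort_id)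

lemma semistandard_star_rows:
  "semistandard R \<Longrightarrow> semistandard S \<Longrightarrow> semistandard (star_rows R S)"
proof (induction R S rule: star_rows.induct)
  case (3 r R s S)
  have RS: "semistandard R" "semistandard S"
    using "3.prems" by (auto simp: semistandard_def successively_Cons)
  have IH: "semistandard (star_rows R S)" using RS by (rule "3.IH")
  have srt: "sorted r" "sorted s" "\<forall>x\<in>set R. sorted x" "\<forall>x\<in>set S. sorted x"
    using "3.prems" by (auto simp: semistandard_def)
  have cs: "R = [] \<or> column_strict r (hd R)" "S = [] \<or> column_strict s (hd S)"
    using "3.prems" by (auto simp: semistandard_def successively_Cons)
  have hd: "star_rows R S = [] \<or> column_strict (sort (r @ s)) (hd (star_rows R S))"
  proof (cases R)
    case Nil
    show ?thesis
    proof (cases S)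
      case (Cons s' S')
      then have "column_strict (sort (r @ s)) s'"
        using srt cs by (intro column_strict_sort2) simp_all
      then show ?thesis using Nil Cons by simp
    qed (simp add: Nil)
  next
    case R: (Cons r' R')
    show ?thesis
    proof (cases S)
      case Nil
      have "column_strict (sort (r @ s)) r'"
        using srt cs R by (intro column_strict_sort1) simp_all
      then show ?thesis using Nil R by simp
    next
      case (Cons s' S')
      then have "column_strict (sort (r @ s)) (sort (r' @ s'))"
        using srt cs R by (intro column_strict_sort_append) simp_all
      then show ?thesis using Cons R by simp
    qed
  qed
  have "sort (r @ s) \<noteq> []" "0 \<notin> set (sort (r @ s))"
    using "3.prems" by (auto simp: semistandard_def dest: arg_cong[of _ _ set])
  with IH hd show ?case
    by (simp add: semistandard_def successively_Cons)
qed auto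

lemma star_rows_commute: "star_rows R S = star_rows S R"
proof (induction R S rule: star_rows.induct)
  case (3 r R s S)
  have "sort (r @ s) = sort (s @ r)"
    by (rule properties_for_sort) (simp_all add: add.commute)
  with 3 show ?case by simp
qed auto

lemma star_rows_assoc:
  "star_rows (star_rows R S) T = star_rows R (star_rows S T)"
proof (induction R S arbitrary: T rule: star_rows.induct)
  case (3 r R s S)
  show ?case
  proof (cases T)
    case (Cons t T')
    have "sort (sort (r @ s) @ t) = sort (r @ sort (s @ t))"
      by (rule properties_for_sort) simp_all
    then show ?thesis using 3 Cons by simp
  qed simp
qed auto

text \<open>The operation \<open>\<star>\<close> on tableaux is written additively, with the empty tableau as \<open>0\<close>, so that
  finitely supported functions on tableaux form a ring under convolution.\<close>

instantiation tableau :: comm_monoid_add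
begin

lift_definition zero_tableau :: tableau is "[]"
  by (simp add: semistandard_def)

lift_definition plus_tableau :: "tableau \<Rightarrow> tableau \<Rightarrow> tableau" is star_rows
  by (rule semistandard_star_rows)

instance
proof
  fix a b c :: tableau
  show "a + b + c = a + (b + c)" by transfer (rule star_rows_assoc)
  show "a + b = b + a" by transfer (rule star_rows_commute)
  show "0 + a = a" by transfer simp
qed

end

definition SSYT :: "nat \<Rightarrow> nat \<Rightarrow> tableau set" where
  "SSYT n m = {T. length (rows T) \<le> n \<and> (\<forall>r\<in>set (rows T). \<forall>a\<in>set r. a \<le> m)}"

text \<open>\<open>wt i j T\<close> is the number of entries \<open>j\<close> in row \<open>i\<close>, with rows numbered from 1.\<close>

definition wt :: "nat \<Rightarrow> nat \<Rightarrow> tableau \<Rightarrow> nat" where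
  "wt i j T = (if 1 \<le> i \<and> i \<le> length (rows T) then count_list (rows T ! (i - 1)) j else 0)"

definition num_columns :: "tableau \<Rightarrow> nat" where
  "num_columns T = (if rows T = [] then 0 else length (hd (rows T)))"

text \<open>\<open>column as\<close> is only meaningful for a strictly increasing list of positive integers.\<close>

definition column :: "nat list \<Rightarrow> tableau" where
  "column as = Tableau (map (\<lambda>a. [a]) as)"

definition G_cols :: "nat \<Rightarrow> nat \<Rightarrow> tableau set" where
  "G_cols n m = {T \<in> SSYT n m. num_columns T = 1}"

definition F_cols :: "nat \<Rightarrow> nat \<Rightarrow> tableau set" where
  "F_cols n m =
     (if m = n then
        (if n = 1 then {column [1]} else {column [n], column [1..<n], column [1..<Suc n]})
      else {column [m], column [1..<Suc n]})"

definition E_cols :: "nat \<Rightarrow> nat \<Rightarrow> tableau set" where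
  "E_cols n m = G_cols n m - F_cols n m"

text \<open>The monoid algebra of a submonoid \<open>S\<close> of an (additively written) commutative monoid, with
  the convolution product of \<^typ>\<open>'a \<Rightarrow>\<^sub>0 'k\<close>.\<close>

definition monoid_algebra :: "'a::comm_monoid_add set \<Rightarrow> ('a \<Rightarrow>\<^sub>0 'k::comm_ring_1) ring" where
  "monoid_algebra S =
     \<lparr>carrier = {f. Poly_Mapping.keys f \<subseteq> S}, monoid.mult = (*), one = 1, zero = 0, add = (+)\<rparr>"

definition embed :: "'a::comm_monoid_add \<Rightarrow> ('a \<Rightarrow>\<^sub>0 'k::comm_ring_1)" where
  "embed s = Poly_Mapping.single s 1"

definition scalar :: "'k \<Rightarrow> ('a::comm_monoid_add \<Rightarrow>\<^sub>0 'k::comm_ring_1)" where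
  "scalar c = Poly_Mapping.single 0 c"

text \<open>The linear extension to \<^term>\<open>monoid_algebra S\<close> of a map \<open>\<chi>\<close> on \<open>S\<close>; it is an algebra
  homomorphism if \<open>\<chi>\<close> is multiplicative.  It is undefined outside the algebra, so that two
  such extensions are equal iff they agree on the algebra.\<close>

definition linear_extension ::
    "'a::comm_monoid_add set \<Rightarrow> ('a \<Rightarrow> 'k::comm_ring_1) \<Rightarrow> ('a \<Rightarrow>\<^sub>0 'k) \<Rightarrow> 'k" where
  "linear_extension S \<chi> =
     (\<lambda>f\<in>carrier (monoid_algebra S). \<Sum>s\<in>Poly_Mapping.keys f. Poly_Mapping.lookup f s * \<chi> s)"

text \<open>Polynomials in the variables \<open>V\<close> form the monoid algebra of the monomials
  \<^typ>\<open>'v \<Rightarrow>\<^sub>0 nat\<close> (exponent vectors) involving only variables from \<open>V\<close>.\<close>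

type_synonym ('v, 'k) polynomial = "('v \<Rightarrow>\<^sub>0 nat) \<Rightarrow>\<^sub>0 'k"

definition monomials :: "'v set \<Rightarrow> ('v \<Rightarrow>\<^sub>0 nat) set" where
  "monomials V = {u. Poly_Mapping.keys u \<subseteq> V}"

definition poly_ring :: "'v set \<Rightarrow> ('v, 'k::comm_ring_1) polynomial ring" where
  "poly_ring V = monoid_algebra (monomials V)"

definition var :: "'v \<Rightarrow> ('v, 'k::comm_ring_1) polynomial" where
  "var v = embed (Poly_Mapping.single v 1)"

definition poly_eval :: "'v set \<Rightarrow> ('v \<Rightarrow> 'k) \<Rightarrow> ('v, 'k::comm_ring_1) polynomial \<Rightarrow> 'k" where
  "poly_eval V \<alpha> = linear_extension (monomials V)
     (\<lambda>u. \<Prod>v\<in>Poly_Mapping.keys u. \<alpha> v ^ Poly_Mapping.lookup u v)"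

type_synonym 'k tableaux_algebra = "tableau \<Rightarrow>\<^sub>0 'k"

definition \<T> :: "nat \<Rightarrow> nat \<Rightarrow> 'k::comm_ring_1 tableaux_algebra ring" where
  "\<T> n m = monoid_algebra (SSYT n m)"

definition product_relations :: "nat \<Rightarrow> nat \<Rightarrow> (tableau, 'k::comm_ring_1) polynomial set" where
  "product_relations n m =
     {var a * var b - var c * var e | a b c e.
        {a, b, c, e} \<subseteq> G_cols n m \<and> distinct [a, b, c, e] \<and> a + b = c + e}"

definition \<P> :: "nat \<Rightarrow> nat \<Rightarrow> (tableau, 'k::comm_ring_1) polynomial set" where
  "\<P> n m = genideal (poly_ring (E_cols n m)) (product_relations n m)"

definition zero_locus :: "'v set \<Rightarrow> ('v, 'k::comm_ring_1) polynomial set \<Rightarrow> ('v \<Rightarrow> 'k) set" where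
  "zero_locus V P = {t \<in> V \<rightarrow>\<^sub>E UNIV. \<forall>p\<in>P. poly_eval V t p = 0}"

text \<open>A point of \<open>\<V>(\<P>) \<times> \<K>\<^bsup>|F|\<^esup>\<close> is a family indexed by \<^term>\<open>G_cols n m\<close> whose restriction to
  \<^term>\<open>E_cols n m\<close> lies in the zero locus.\<close>

definition points :: "nat \<Rightarrow> nat \<Rightarrow> (tableau \<Rightarrow> 'k::comm_ring_1) set" where
  "points n m =
     {t \<in> G_cols n m \<rightarrow>\<^sub>E UNIV. restrict t (E_cols n m) \<in> zero_locus (E_cols n m) (\<P> n m)}"

definition J_pts :: "nat \<Rightarrow> nat \<Rightarrow> (tableau \<Rightarrow> 'k::comm_ring_1) set" where
  "J_pts n m = {t \<in> points n m. \<forall>T\<in>G_cols n m. t T \<noteq> 0}"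

definition M_ideal :: "nat \<Rightarrow> nat \<Rightarrow> (tableau \<Rightarrow> 'k::comm_ring_1) \<Rightarrow> 'k tableaux_algebra set" where
  "M_ideal n m t = genideal (\<T> n m) {embed T - scalar (t T) | T. T \<in> G_cols n m}"

text \<open>The quotient map \<open>\<T> \<rightarrow> \<T>/M\<^sub>t\<close>, followed by the identification of \<open>\<T>/M\<^sub>t\<close> with the field
  under which \<open>c\<close> corresponds to the coset of the scalar \<open>c\<close>.\<close>

definition quot_map ::
    "nat \<Rightarrow> nat \<Rightarrow> (tableau \<Rightarrow> 'k::comm_ring_1) \<Rightarrow> 'k tableaux_algebra \<Rightarrow> 'k" where
  "quot_map n m t = (\<lambda>f\<in>carrier (\<T> n m).
     THE c. M_ideal n m t +>\<^bsub>\<T> n m\<^esub> f = M_ideal n m t +>\<^bsub>\<T> n m\<^esub> scalar c)"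

text \<open>For a set \<open>S\<close> of families indexed by \<open>A\<close> and a parametrization \<open>\<phi>\<close> of \<open>\<phi> ` S\<close>: the structure
  on \<open>\<phi> ` S\<close> with product \<open>\<phi> a \<circledast> \<phi> b = \<phi> (a b)\<close>, where \<open>a b\<close> is the entrywise product.\<close>

definition entrywise_group ::
    "'i set \<Rightarrow> ('i \<Rightarrow> 'k::comm_ring_1) set \<Rightarrow> (('i \<Rightarrow> 'k) \<Rightarrow> 'b) \<Rightarrow> 'b monoid" where
  "entrywise_group A S \<phi> =
     \<lparr>carrier = \<phi> ` S,
      monoid.mult = (\<lambda>x y. THE z. \<exists>a\<in>S. \<exists>b\<in>S. x = \<phi> a \<and> y = \<phi> b \<and> z = \<phi> (\<lambda>i\<in>A. a i * b i)),
      one = \<phi> (\<lambda>i\<in>A. 1)\<rparr>"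

definition M_ord :: "nat \<Rightarrow> nat \<Rightarrow> 'k::comm_ring_1 tableaux_algebra set monoid" where
  "M_ord n m = entrywise_group (G_cols n m) (J_pts n m) (M_ideal n m)"

definition Pr0 :: "nat \<Rightarrow> nat \<Rightarrow> ('k::comm_ring_1 tableaux_algebra \<Rightarrow> 'k) monoid" where
  "Pr0 n m = entrywise_group (G_cols n m) (J_pts n m) (quot_map n m)"

text \<open>The pair \<open>(i, j)\<close> stands for the variable \<open>x\<^sub>j\<^bsup>(i)\<^esup>\<close>.\<close>

definition X_vars :: "nat \<Rightarrow> nat \<Rightarrow> (nat \<times> nat) set" where
  "X_vars n m = {1..n} \<times> {1..m}"

definition ev ::
    "nat \<Rightarrow> nat \<Rightarrow> (nat \<times> nat \<Rightarrow> 'k::comm_ring_1) \<Rightarrow> (nat \<times> nat, 'k) polynomial \<Rightarrow> 'k" where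
  "ev n m \<alpha> = poly_eval (X_vars n m) \<alpha>"

definition I_pts :: "nat \<Rightarrow> nat \<Rightarrow> (nat \<times> nat \<Rightarrow> 'k::comm_ring_1) set" where
  "I_pts n m = {\<alpha> \<in> X_vars n m \<rightarrow>\<^sub>E UNIV. \<forall>p\<in>X_vars n m. \<alpha> p \<noteq> 0}"

definition Ev0 :: "nat \<Rightarrow> nat \<Rightarrow> ((nat \<times> nat, 'k::comm_ring_1) polynomial \<Rightarrow> 'k) monoid" where
  "Ev0 n m = entrywise_group (X_vars n m) (I_pts n m) (ev n m)"

definition tableau_ev ::
    "nat \<Rightarrow> nat \<Rightarrow> (nat \<times> nat \<Rightarrow> 'k::comm_ring_1) \<Rightarrow> 'k tableaux_algebra \<Rightarrow> 'k" where
  "tableau_ev n m \<alpha> =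
     linear_extension (SSYT n m) (\<lambda>T. \<Prod>(i, j)\<in>X_vars n m. \<alpha> (i, j) ^ wt i j T)"

definition \<Psi> :: "nat \<Rightarrow> nat \<Rightarrow> (nat \<times> nat \<Rightarrow> 'k::comm_ring_1) \<Rightarrow> tableau \<Rightarrow> 'k" where
  "\<Psi> n m \<alpha> = (\<lambda>T\<in>G_cols n m. tableau_ev n m \<alpha> (embed T))"

definition \<Psi>0 ::
    "nat \<Rightarrow> nat \<Rightarrow> ((nat \<times> nat, 'k::comm_ring_1) polynomial \<Rightarrow> 'k) \<Rightarrow>
       'k tableaux_algebra \<Rightarrow> 'k" where
  "\<Psi>0 n m f = (THE p. \<exists>\<alpha>\<in>I_pts n m. f = ev n m \<alpha> \<and> p = quot_map n m (\<Psi> n m \<alpha>))"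

end

theory Submission
  imports Defs
begin

text \<open>
  Evaluation at \<open>\<alpha>\<close> restricts to a multiplicative map \<open>\<chi>\<close> on tableaux, the product of
  \<open>\<alpha>\<^sub>i\<^sub>j\<close> over all entries \<open>j\<close> in row \<open>i\<close>, and \<open>\<Psi>(\<alpha>)\<close> is the family of its values on the
  one-column tableaux.  Since every tableau is a product of its columns, modulo the binomials
  \<open>T - \<chi>(T)\<close> with \<open>T\<close> a column each element of the tableaux algebra is congruent to its value
  under evaluation.  So the ideal at the point \<open>\<Psi>(\<alpha>)\<close> is exactly the kernel of evaluation
  (lemma \<open>M_ideal_\<Psi>\<close>), and the quotient map there is evaluation itself
  (lemma \<open>quot_map_\<Psi>\<close>).

  The heart of the matter is surjectivity: every point \<open>t\<close> with nonzero coordinates is some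
  \<open>\<Psi>(\<alpha>)\<close> (lemma \<open>J_pts_subset_range_\<Psi>\<close>).  Put
  \<open>\<alpha>\<^sub>i\<^sub>j = t[1, \<dots>, i - 1, j] / t[1, \<dots>, i - 1]\<close> for \<open>i \<le> j\<close>, reading
  the value at the empty column as \<open>1\<close>.  The product relation
  \<open>[a\<^sub>1, \<dots>, a\<^sub>k, x] \<star> [1, \<dots>, k] = [a\<^sub>1, \<dots>, a\<^sub>k] \<star> [1, \<dots>, k, x]\<close> then gives
  \<open>t[a\<^sub>1, \<dots>, a\<^sub>k, x] = t[a\<^sub>1, \<dots>, a\<^sub>k] \<alpha>\<^sub>k\<^sub>+\<^sub>1\<^sub>,\<^sub>x\<close>, so that \<open>t\<close> agrees with
  \<open>\<Psi>(\<alpha>)\<close> on all columns, by induction on their height.  To use such relations for an arbitrary point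
  they have to be polynomials in the variables \<open>E\<close> only; that columns in \<open>F\<close> never take part
  in a product relation is lemma \<open>relation_subset_E_cols\<close>.

  Every point with nonzero coordinates is thus of the form \<open>\<Psi>(\<alpha>)\<close>, and it can be read off from
  its quotient map, hence from its ideal.  Therefore both parametrizations are injective, the
  entrywise products are well defined, and all three structures are groups.  As \<open>\<Psi>\<close> respects
  entrywise products, \<open>\<Psi>0\<close> is a surjective homomorphism.  The condition \<open>\<Psi>(\<alpha>) = 1\<close> forces the
  quotients above, that is all \<open>\<alpha>\<^sub>i\<^sub>j\<close> with \<open>i \<le> j\<close>, to be \<open>1\<close>; conversely this suffices because
  the entry in row \<open>i\<close> of a column is at least \<open>i\<close>.  The isomorphism theorem for groups finishes
  the proof.
\<close>

section \<open>Monoid algebras and their characters\<close>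

locale additive_submonoid =
  fixes S :: "'a::comm_monoid_add set"
  assumes zero_mem: "0 \<in> S"
    and add_mem: "s \<in> S \<Longrightarrow> t \<in> S \<Longrightarrow> s + t \<in> S"

lemma monoid_algebra_simps:
  "carrier (monoid_algebra S) = {f. Poly_Mapping.keys f \<subseteq> S}"
  "f \<otimes>\<^bsub>monoid_algebra S\<^esub> g = f * g"
  "f \<oplus>\<^bsub>monoid_algebra S\<^esub> g = f + g"
  "\<one>\<^bsub>monoid_algebra S\<^esub> = 1"
  "\<zero>\<^bsub>monoid_algebra S\<^esub> = 0"
  by (simp_all add: monoid_algebra_def)

lemma keys_uminus: "Poly_Mapping.keys (- f) = Poly_Mapping.keys f"
  by (auto simp: in_keys_iff)

lemma (in additive_submonoid) cring_monoid_algebra: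
  "cring (monoid_algebra S :: ('a \<Rightarrow>\<^sub>0 'k::comm_ring_1) ring)"
proof (intro cringI abelian_groupI comm_monoidI)
  let ?R = "monoid_algebra S :: ('a \<Rightarrow>\<^sub>0 'k) ring"
  fix f assume f: "f \<in> carrier ?R"
  then have "- f \<in> carrier ?R" "- f + f = 0"
    by (simp_all add: monoid_algebra_simps keys_uminus)
  then show "\<exists>g\<in>carrier ?R. g \<oplus>\<^bsub>?R\<^esub> f = \<zero>\<^bsub>?R\<^esub>"
    unfolding monoid_algebra_simps by blast
next
  let ?R = "monoid_algebra S :: ('a \<Rightarrow>\<^sub>0 'k) ring"
  fix f g assume f: "f \<in> carrier ?R" and g: "g \<in> carrier ?R"
  show "f \<oplus>\<^bsub>?R\<^esub> g \<in> carrier ?R"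
    using f g Poly_Mapping.keys_add[of f g] by (auto simp: monoid_algebra_simps)
  show "f \<otimes>\<^bsub>?R\<^esub> g \<in> carrier ?R"
    using f g Poly_Mapping.keys_mult[of f g] add_mem by (fastforce simp: monoid_algebra_simps)
qed (use zero_mem in \<open>auto simp: monoid_algebra_simps algebra_simps\<close>)

lemma (in additive_submonoid) ring_monoid_algebra:
  "ring (monoid_algebra S :: ('a \<Rightarrow>\<^sub>0 'k::comm_ring_1) ring)"
  using cring_monoid_algebra by (rule cring.axioms)

lemma (in additive_submonoid) a_inv_monoid_algebra:
  fixes f :: "'a \<Rightarrow>\<^sub>0 'k::comm_ring_1"
  assumes "f \<in> carrier (monoid_algebra S)"
  shows "\<ominus>\<^bsub>monoid_algebra S\<^esub> f = - f"
proof -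
  interpret R: ring "monoid_algebra S :: ('a \<Rightarrow>\<^sub>0 'k) ring" by (rule ring_monoid_algebra)
  have "- f \<in> carrier (monoid_algebra S)" "- f \<oplus>\<^bsub>monoid_algebra S\<^esub> f = \<zero>\<^bsub>monoid_algebra S\<^esub>"
    using assms by (simp_all add: monoid_algebra_simps keys_uminus)
  then show ?thesis using assms R.minus_equality by metis
qed

lemma (in additive_submonoid) a_minus_monoid_algebra:
  fixes f g :: "'a \<Rightarrow>\<^sub>0 'k::comm_ring_1"
  assumes "g \<in> carrier (monoid_algebra S)"
  shows "f \<ominus>\<^bsub>monoid_algebra S\<^esub> g = f - g"
  using assms by (simp add: a_minus_def a_inv_monoid_algebra monoid_algebra_simps)

lemma embed_mem_monoid_algebra: "s \<in> S \<Longrightarrow> embed s \<in> carrier (monoid_algebra S)"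
  by (auto simp: monoid_algebra_simps embed_def)

lemma (in additive_submonoid) scalar_mem_monoid_algebra:
  "scalar c \<in> carrier (monoid_algebra S)"
  using zero_mem by (auto simp: monoid_algebra_simps scalar_def)

lemma embed_add: "embed (s + t) = embed s * embed t"
  by (simp add: embed_def mult_single)

lemma embed_zero: "embed 0 = scalar 1"
  by (simp add: embed_def scalar_def)

lemma scalar_mult: "scalar (c * d) = scalar c * scalar d"
  by (simp add: scalar_def mult_single)

lemma scalar_sum: "scalar (sum c A) = (\<Sum>a\<in>A. scalar (c a))"
  by (rule poly_mapping_eqI) (simp add: lookup_sum scalar_def lookup_single when_def)

lemma scalar_zero: "scalar 0 = 0"
  by (simp add: scalar_def)

text \<open>This decomposition reduces statements about the algebra to statements about the monoid.\<close>

lemma eq_sum_scalar_embed: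
  "f = (\<Sum>s\<in>Poly_Mapping.keys f. scalar (Poly_Mapping.lookup f s) * embed s)"
proof (rule poly_mapping_eqI)
  fix k
  have "(\<Sum>s\<in>Poly_Mapping.keys f. Poly_Mapping.lookup f s when s = k) = Poly_Mapping.lookup f k"
    by (simp add: when_def in_keys_iff)
  then show "Poly_Mapping.lookup f k = Poly_Mapping.lookup
      (\<Sum>s\<in>Poly_Mapping.keys f. scalar (Poly_Mapping.lookup f s) * embed s) k"
    by (simp add: lookup_sum scalar_def embed_def mult_single lookup_single)
qed

text \<open>Unlike its restriction to one algebra, this sum is additive for all arguments, so that no
  carrier conditions arise in calculations with sums.\<close>

definition weighted_sum :: "('a \<Rightarrow> 'k) \<Rightarrow> ('a \<Rightarrow>\<^sub>0 'k::comm_ring_1) \<Rightarrow> 'k" where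
  "weighted_sum \<chi> f = (\<Sum>s\<in>Poly_Mapping.keys f. Poly_Mapping.lookup f s * \<chi> s)"

lemma linear_extension_eq_weighted_sum:
  "f \<in> carrier (monoid_algebra S) \<Longrightarrow> linear_extension S \<chi> f = weighted_sum \<chi> f"
  by (simp add: linear_extension_def weighted_sum_def)

lemma weighted_sum_superset:
  assumes "finite A" "Poly_Mapping.keys f \<subseteq> A"
  shows "weighted_sum \<chi> f = (\<Sum>s\<in>A. Poly_Mapping.lookup f s * \<chi> s)"
  unfolding weighted_sum_def
  by (rule sum.mono_neutral_left) (use assms in \<open>auto simp: in_keys_iff\<close>)

lemma weighted_sum_add: "weighted_sum \<chi> (f + g) = weighted_sum \<chi> f + weighted_sum \<chi> g"
proof -
  let ?A = "Poly_Mapping.keys f \<union> Poly_Mapping.keys g"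
  have "weighted_sum \<chi> h = (\<Sum>s\<in>?A. Poly_Mapping.lookup h s * \<chi> s)" if "h \<in> {f, g, f + g}" for h
    using that Poly_Mapping.keys_add[of f g] by (intro weighted_sum_superset) auto
  then show ?thesis by (simp add: lookup_add sum.distrib distrib_right)
qed

lemma weighted_sum_zero [simp]: "weighted_sum \<chi> 0 = 0"
  by (simp add: weighted_sum_def)

lemma weighted_sum_diff: "weighted_sum \<chi> (f - g) = weighted_sum \<chi> f - weighted_sum \<chi> g"
  using weighted_sum_add[of \<chi> "f - g" g] by simp

lemma weighted_sum_sum: "weighted_sum \<chi> (sum F A) = (\<Sum>a\<in>A. weighted_sum \<chi> (F a))"
  by (induction A rule: infinite_finite_induct) (simp_all add: weighted_sum_add)

lemma weighted_sum_single [simp]: "weighted_sum \<chi> (Poly_Mapping.single s c) = c * \<chi> s"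
  by (simp add: weighted_sum_def)

text \<open>Multiplicative maps on the monoid correspond to algebra homomorphisms on the monoid algebra.\<close>

locale monoid_character = additive_submonoid S
  for S :: "'a::comm_monoid_add set" +
  fixes \<chi> :: "'a \<Rightarrow> 'k::comm_ring_1"
  assumes char_zero: "\<chi> 0 = 1"
    and char_add: "s \<in> S \<Longrightarrow> t \<in> S \<Longrightarrow> \<chi> (s + t) = \<chi> s * \<chi> t"
begin

lemma linear_extension_embed: "s \<in> S \<Longrightarrow> linear_extension S \<chi> (embed s) = \<chi> s"
  by (simp add: linear_extension_eq_weighted_sum embed_mem_monoid_algebra)
     (simp add: embed_def)

lemma linear_extension_scalar: "linear_extension S \<chi> (scalar c) = c"
  by (simp add: linear_extension_eq_weighted_sum scalar_mem_monoid_algebra)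
     (simp add: scalar_def char_zero)

lemma linear_extension_diff:
  assumes "f \<in> carrier (monoid_algebra S)" "g \<in> carrier (monoid_algebra S)"
  shows "linear_extension S \<chi> (f - g) = linear_extension S \<chi> f - linear_extension S \<chi> g"
proof -
  interpret R: ring "monoid_algebra S :: ('a \<Rightarrow>\<^sub>0 'k) ring" by (rule ring_monoid_algebra)
  have "f - g \<in> carrier (monoid_algebra S)"
    using R.minus_closed[OF assms] assms by (simp add: a_minus_monoid_algebra)
  then show ?thesis
    using assms by (simp add: linear_extension_eq_weighted_sum weighted_sum_diff)
qed

lemma linear_extension_add:
  assumes "f \<in> carrier (monoid_algebra S)" "g \<in> carrier (monoid_algebra S)"
  shows "linear_extension S \<chi> (f + g) = linear_extension S \<chi> f + linear_extension S \<chi> g"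
proof -
  interpret R: ring "monoid_algebra S :: ('a \<Rightarrow>\<^sub>0 'k) ring" by (rule ring_monoid_algebra)
  have "f + g \<in> carrier (monoid_algebra S)"
    using R.a_closed[OF assms] by (simp add: monoid_algebra_simps)
  then show ?thesis
    using assms by (simp add: linear_extension_eq_weighted_sum weighted_sum_add)
qed

lemma linear_extension_mult:
  assumes "f \<in> carrier (monoid_algebra S)" "g \<in> carrier (monoid_algebra S)"
  shows "linear_extension S \<chi> (f * g) = linear_extension S \<chi> f * linear_extension S \<chi> g"
proof -
  interpret R: ring "monoid_algebra S :: ('a \<Rightarrow>\<^sub>0 'k) ring" by (rule ring_monoid_algebra)
  have fg: "f * g \<in> carrier (monoid_algebra S)"
    using R.m_closed[OF assms] by (simp add: monoid_algebra_simps)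
  let ?F = "Poly_Mapping.keys f" and ?G = "Poly_Mapping.keys g"
  let ?f = "Poly_Mapping.lookup f" and ?g = "Poly_Mapping.lookup g"
  have "f * g = (\<Sum>s\<in>?F. \<Sum>t\<in>?G. Poly_Mapping.single (s + t) (?f s * ?g t))"
    by (subst eq_sum_scalar_embed[of f], subst eq_sum_scalar_embed[of g])
       (simp add: sum_product scalar_def embed_def mult_single)
  then have "weighted_sum \<chi> (f * g) = (\<Sum>s\<in>?F. \<Sum>t\<in>?G. ?f s * ?g t * \<chi> (s + t))"
    by (simp add: weighted_sum_sum)
  also have "\<dots> = (\<Sum>s\<in>?F. \<Sum>t\<in>?G. (?f s * \<chi> s) * (?g t * \<chi> t))"
    using assms by (intro sum.cong refl) (auto simp: char_add monoid_algebra_simps subset_iff)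
  also have "\<dots> = weighted_sum \<chi> f * weighted_sum \<chi> g"
    by (simp add: weighted_sum_def sum_product)
  finally show ?thesis
    using assms fg by (simp add: linear_extension_eq_weighted_sum)
qed

lemma ideal_kernel:
  "ideal {f \<in> carrier (monoid_algebra S). linear_extension S \<chi> f = 0} (monoid_algebra S)"
    (is "ideal ?K ?R")
proof -
  interpret R: ring "monoid_algebra S :: ('a \<Rightarrow>\<^sub>0 'k) ring" by (rule ring_monoid_algebra)
  show ?thesis
  proof (rule idealI)
    show "ring ?R" by (rule ring_monoid_algebra)
    show "subgroup ?K (add_monoid ?R)"
    proof (rule R.add.subgroupI)
      have "\<zero>\<^bsub>?R\<^esub> \<in> ?K"
        using R.zero_closed
        by (auto simp: linear_extension_eq_weighted_sum simp del: R.zero_closed)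
           (simp add: monoid_algebra_simps)
      then show "?K \<noteq> {}" by blast
    next
      fix f assume f: "f \<in> ?K"
      have "linear_extension S \<chi> (\<zero>\<^bsub>?R\<^esub> - f) = 0"
        using f linear_extension_diff[of "\<zero>\<^bsub>?R\<^esub>" f] R.zero_closed
        by (simp add: linear_extension_eq_weighted_sum) (simp add: monoid_algebra_simps)
      then show "\<ominus>\<^bsub>?R\<^esub> f \<in> ?K"
        using f R.a_inv_closed[of f] by (simp add: a_inv_monoid_algebra monoid_algebra_simps)
    next
      fix f g assume "f \<in> ?K" "g \<in> ?K"
      then show "f \<oplus>\<^bsub>?R\<^esub> g \<in> ?K"
        using R.a_closed[of f g] linear_extension_add[of f g]
        by (simp add: monoid_algebra_simps(3))
    qed auto
  next
    fix f g assume fg: "f \<in> ?K" "g \<in> carrier ?R"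
    then show "g \<otimes>\<^bsub>?R\<^esub> f \<in> ?K"
      using R.m_closed[of g f] linear_extension_mult[of g f] by (simp add: monoid_algebra_simps(2))
    show "f \<otimes>\<^bsub>?R\<^esub> g \<in> ?K"
      using fg R.m_closed[of f g] linear_extension_mult[of f g]
      by (simp add: monoid_algebra_simps(2))
  qed
qed

text \<open>Modulo the binomials \<open>g - \<chi>(g)\<close> with \<open>g\<close> from a generating set every monoid element is
  congruent to its character value; hence so is every element of the algebra, which leaves no room
  between the generated ideal and the kernel.  The second assumption says that \<open>G\<close> generates
  \<open>S\<close>, in the form of an induction principle.\<close>

lemma genideal_generators_eq_kernel:
  assumes G: "G \<subseteq> S"
    and gen: "\<And>P s. s \<in> S \<Longrightarrow> P 0 \<Longrightarrow> (\<And>g t. g \<in> G \<Longrightarrow> t \<in> S \<Longrightarrow> P t \<Longrightarrow> P (g + t)) \<Longrightarrow> P s"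
  shows "genideal (monoid_algebra S) {embed g - scalar (\<chi> g) | g. g \<in> G} =
    {f \<in> carrier (monoid_algebra S). linear_extension S \<chi> f = 0}"
    (is "genideal ?R ?B = ?K")
proof
  interpret R: ring "monoid_algebra S :: ('a \<Rightarrow>\<^sub>0 'k) ring" by (rule ring_monoid_algebra)
  have BK: "?B \<subseteq> ?K"
  proof
    fix f assume "f \<in> ?B"
    then obtain g where g: "g \<in> S" "f = embed g - scalar (\<chi> g)" using G by blast
    have "f \<in> carrier ?R"
      using R.minus_closed[OF embed_mem_monoid_algebra[OF g(1)] scalar_mem_monoid_algebra, of "\<chi> g"] g
      by (simp add: a_minus_monoid_algebra scalar_mem_monoid_algebra)
    then show "f \<in> ?K"
      using g by (simp add: linear_extension_diff embed_mem_monoid_algebra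
          scalar_mem_monoid_algebra linear_extension_embed linear_extension_scalar)
  qed
  show "genideal ?R ?B \<subseteq> ?K"
    using ideal_kernel BK by (rule R.genideal_minimal)
  let ?I = "genideal ?R ?B"
  have B: "?B \<subseteq> carrier ?R" using BK by blast
  interpret I: ideal ?I ?R using B by (rule R.genideal_ideal)
  have add: "f + g \<in> ?I" if "f \<in> ?I" "g \<in> ?I" for f g
    using I.a_closed[OF that] by (simp add: monoid_algebra_simps)
  have mult: "h * f \<in> ?I" if "f \<in> ?I" "h \<in> carrier ?R" for f h
    using I.I_l_closed[OF that] by (simp add: monoid_algebra_simps)
  have zero: "0 \<in> ?I"
    using I.zero_closed by (simp add: monoid_algebra_simps)
  have mon: "embed s - scalar (\<chi> s) \<in> ?I" if "s \<in> S" for s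
    using that
  proof (rule gen)
    show "embed 0 - scalar (\<chi> 0) \<in> ?I" by (simp add: embed_zero char_zero zero)
  next
    fix g t assume gt: "g \<in> G" "t \<in> S" "embed t - scalar (\<chi> t) \<in> ?I"
    \<comment> \<open>the usual splitting \<open>gt - \<chi>(g)\<chi>(t) = g(t - \<chi>(t)) + \<chi>(t)(g - \<chi>(g))\<close>\<close>
    have "embed (g + t) - scalar (\<chi> (g + t)) =
        embed g * (embed t - scalar (\<chi> t)) + scalar (\<chi> t) * (embed g - scalar (\<chi> g))"
      using gt G by (simp add: embed_add char_add subset_iff scalar_mult algebra_simps)
    moreover have "embed g - scalar (\<chi> g) \<in> ?I"
      using R.genideal_self[OF B] gt by blast
    ultimately show "embed (g + t) - scalar (\<chi> (g + t)) \<in> ?I"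
      using gt G by (auto intro!: add mult embed_mem_monoid_algebra scalar_mem_monoid_algebra)
  qed
  show "?K \<subseteq> ?I"
  proof
    fix f assume f: "f \<in> ?K"
    let ?F = "Poly_Mapping.keys f"
    let ?f = "Poly_Mapping.lookup f"
    have "scalar (\<Sum>s\<in>?F. ?f s * \<chi> s) = (0 :: 'a \<Rightarrow>\<^sub>0 'k)"
      using f linear_extension_eq_weighted_sum[of f S \<chi>]
      by (simp add: weighted_sum_def scalar_zero)
    then have "f = (\<Sum>s\<in>?F. scalar (?f s) * embed s) - scalar (\<Sum>s\<in>?F. ?f s * \<chi> s)"
      by (simp flip: eq_sum_scalar_embed)
    also have "\<dots> = (\<Sum>s\<in>?F. scalar (?f s) * (embed s - scalar (\<chi> s)))"
      by (simp add: scalar_sum scalar_mult right_diff_distrib sum_subtractf)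
    finally have eq: "f = (\<Sum>s\<in>?F. scalar (?f s) * (embed s - scalar (\<chi> s)))" .
    have sum_mem: "sum c A \<in> ?I" if "\<And>s. s \<in> A \<Longrightarrow> c s \<in> ?I" for c and A :: "'a set"
      using that by (induction A rule: infinite_finite_induct) (auto intro: add zero)
    have "scalar (?f s) * (embed s - scalar (\<chi> s)) \<in> ?I" if "s \<in> ?F" for s
    proof -
      have "s \<in> S" using f that by (auto simp: monoid_algebra_simps)
      then show ?thesis by (intro mult mon scalar_mem_monoid_algebra)
    qed
    then have "(\<Sum>s\<in>?F. scalar (?f s) * (embed s - scalar (\<chi> s))) \<in> ?I"
      by (rule sum_mem)
    then show "f \<in> ?I" by (simp only: eq[symmetric])
  qed
qed

text \<open>In the quotient by the kernel each element has the scalar that is its value as unique scalar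
  representative.\<close>

lemma kernel_coset_scalar_eq_iff:
  assumes "f \<in> carrier (monoid_algebra S)"
  defines "K \<equiv> {f \<in> carrier (monoid_algebra S). linear_extension S \<chi> f = 0}"
  shows "K +>\<^bsub>monoid_algebra S\<^esub> f = K +>\<^bsub>monoid_algebra S\<^esub> scalar c \<longleftrightarrow>
    c = linear_extension S \<chi> f"
proof -
  interpret R: ring "monoid_algebra S :: ('a \<Rightarrow>\<^sub>0 'k) ring" by (rule ring_monoid_algebra)
  have "K +>\<^bsub>monoid_algebra S\<^esub> f = K +>\<^bsub>monoid_algebra S\<^esub> scalar c \<longleftrightarrow>
      f \<ominus>\<^bsub>monoid_algebra S\<^esub> scalar c \<in> K"
    using R.quotient_eq_iff_same_a_r_cos[OF ideal_kernel assms(1) scalar_mem_monoid_algebra]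
    unfolding K_def by simp
  also have "\<dots> \<longleftrightarrow> linear_extension S \<chi> (f - scalar c) = 0"
    using R.minus_closed[OF assms(1) scalar_mem_monoid_algebra, of c]
    by (simp add: K_def a_minus_monoid_algebra scalar_mem_monoid_algebra)
  also have "\<dots> \<longleftrightarrow> c = linear_extension S \<chi> f"
    using assms(1)
    by (auto simp: linear_extension_diff scalar_mem_monoid_algebra linear_extension_scalar)
  finally show ?thesis .
qed

end

section \<open>Polynomial evaluation\<close>

lemma additive_submonoid_monomials: "additive_submonoid (monomials V)"
proof
  show "s + t \<in> monomials V" if "s \<in> monomials V" "t \<in> monomials V" for s t
    using that Poly_Mapping.keys_add[of s t] by (auto simp: monomials_def)
qed (simp add: monomials_def)

lemma prod_keys_superset:
  fixes \<alpha> :: "'v \<Rightarrow> 'k::comm_ring_1" and u :: "'v \<Rightarrow>\<^sub>0 nat"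
  assumes "finite A" "Poly_Mapping.keys u \<subseteq> A"
  shows "(\<Prod>v\<in>Poly_Mapping.keys u. \<alpha> v ^ Poly_Mapping.lookup u v) =
    (\<Prod>v\<in>A. \<alpha> v ^ Poly_Mapping.lookup u v)"
  by (rule prod.mono_neutral_left) (use assms in \<open>auto simp: in_keys_iff\<close>)

lemma monoid_character_monomials:
  fixes \<alpha> :: "'v \<Rightarrow> 'k::comm_ring_1"
  shows "monoid_character (monomials V)
    (\<lambda>u. \<Prod>v\<in>Poly_Mapping.keys u. \<alpha> v ^ Poly_Mapping.lookup u v)"
proof -
  interpret additive_submonoid "monomials V" by (rule additive_submonoid_monomials)
  show ?thesis
  proof
    fix s t :: "'v \<Rightarrow>\<^sub>0 nat"
    let ?A = "Poly_Mapping.keys s \<union> Poly_Mapping.keys t"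
    let ?c = "\<lambda>u::'v \<Rightarrow>\<^sub>0 nat. \<Prod>v\<in>Poly_Mapping.keys u. \<alpha> v ^ Poly_Mapping.lookup u v"
    have c: "?c u = (\<Prod>v\<in>?A. \<alpha> v ^ Poly_Mapping.lookup u v)" if "u \<in> {s, t, s + t}" for u
      using that Poly_Mapping.keys_add[of s t] by (intro prod_keys_superset) auto
    have "?c (s + t) = (\<Prod>v\<in>?A. \<alpha> v ^ Poly_Mapping.lookup (s + t) v)"
      by (rule c) simp
    also have "\<dots> = (\<Prod>v\<in>?A. \<alpha> v ^ Poly_Mapping.lookup s v) * (\<Prod>v\<in>?A. \<alpha> v ^ Poly_Mapping.lookup t v)"
      by (simp add: lookup_add power_add prod.distrib)
    also have "\<dots> = ?c s * ?c t"
      by (simp only: c[of s] c[of t] insert_iff simp_thms)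
    finally show "?c (s + t) = ?c s * ?c t" .
  qed simp
qed

lemma var_mem: "v \<in> V \<Longrightarrow> var v \<in> carrier (poly_ring V)"
  unfolding var_def poly_ring_def by (rule embed_mem_monoid_algebra) (simp add: monomials_def)

lemma poly_eval_var: "v \<in> V \<Longrightarrow> poly_eval V \<alpha> (var v) = \<alpha> v"
proof -
  interpret monoid_character "monomials V"
    "\<lambda>u. \<Prod>v\<in>Poly_Mapping.keys u. \<alpha> v ^ Poly_Mapping.lookup u v"
    by (rule monoid_character_monomials)
  assume "v \<in> V"
  then show ?thesis
    unfolding poly_eval_def var_def by (subst linear_extension_embed) (auto simp: monomials_def)
qed

lemma poly_eval_binomial:
  fixes \<alpha> :: "'v \<Rightarrow> 'k::comm_ring_1"
  assumes "{a, b, c, e} \<subseteq> V"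
  shows "(var a * var b - var c * var e :: ('v, 'k) polynomial) \<in> carrier (poly_ring V)"
    and "poly_eval V \<alpha> (var a * var b - var c * var e) = \<alpha> a * \<alpha> b - \<alpha> c * \<alpha> e"
proof -
  interpret monoid_character "monomials V"
    "\<lambda>u. \<Prod>v\<in>Poly_Mapping.keys u. \<alpha> v ^ Poly_Mapping.lookup u v"
    by (rule monoid_character_monomials)
  interpret R: ring "monoid_algebra (monomials V) :: ('v, 'k) polynomial ring"
    by (rule ring_monoid_algebra)
  have v: "(var x :: ('v, 'k) polynomial) \<in> carrier (monoid_algebra (monomials V))" if "x \<in> {a, b, c, e}" for x
    using that assms var_mem[of x V] by (auto simp: poly_ring_def)
  have vv: "(var x * var y :: ('v, 'k) polynomial) \<in> carrier (monoid_algebra (monomials V))"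
    if "x \<in> {a, b, c, e}" "y \<in> {a, b, c, e}" for x y
    using R.m_closed[OF v[OF that(1)] v[OF that(2)]] by (simp only: monoid_algebra_simps(2))
  show "(var a * var b - var c * var e :: ('v, 'k) polynomial) \<in> carrier (poly_ring V)"
    using R.minus_closed[OF vv[of a b] vv[of c e]] vv[of c e]
    by (simp add: poly_ring_def a_minus_monoid_algebra)
  have "poly_eval V \<alpha> (var x) = \<alpha> x" if "x \<in> {a, b, c, e}" for x
    using that assms by (intro poly_eval_var) auto
  then show "poly_eval V \<alpha> (var a * var b - var c * var e) = \<alpha> a * \<alpha> b - \<alpha> c * \<alpha> e"
    using v vv unfolding poly_eval_def by (simp add: linear_extension_diff linear_extension_mult)
qed

text \<open>The zero locus of an ideal is cut out by any generators, because the polynomials vanishing at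
  a point form an ideal.\<close>

lemma zero_locus_genideal:
  fixes P :: "('v, 'k::comm_ring_1) polynomial set"
  assumes "P \<subseteq> carrier (poly_ring V)"
  shows "zero_locus V (genideal (poly_ring V) P) = zero_locus V P"
proof -
  interpret additive_submonoid "monomials V" by (rule additive_submonoid_monomials)
  interpret R: ring "poly_ring V :: ('v, 'k) polynomial ring"
    unfolding poly_ring_def by (rule ring_monoid_algebra)
  have "genideal (poly_ring V) P \<subseteq> {f \<in> carrier (poly_ring V). poly_eval V t f = 0}"
    if "\<forall>p\<in>P. poly_eval V t p = 0" for t
    using monoid_character.ideal_kernel[OF monoid_character_monomials, of V t] that assms
    by (intro R.genideal_minimal) (auto simp: poly_ring_def poly_eval_def)
  then show ?thesis
    using R.genideal_self[OF assms] unfolding zero_locus_def by blast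
qed

section \<open>Groups of families under entrywise multiplication\<close>

text \<open>The product of a group of parametrized objects is defined by choosing parameters; injectivity
  of \<open>\<phi>\<close> makes it independent of the choice.\<close>

locale entrywise_families =
  fixes A :: "'i set" and S :: "('i \<Rightarrow> 'k::field) set" and \<phi> :: "('i \<Rightarrow> 'k) \<Rightarrow> 'b"
  assumes ext: "S \<subseteq> extensional A"
    and nonzero: "a \<in> S \<Longrightarrow> i \<in> A \<Longrightarrow> a i \<noteq> 0"
    and one_mem: "(\<lambda>i\<in>A. 1) \<in> S"
    and mult_mem: "a \<in> S \<Longrightarrow> b \<in> S \<Longrightarrow> (\<lambda>i\<in>A. a i * b i) \<in> S"
    and inverse_mem: "a \<in> S \<Longrightarrow> (\<lambda>i\<in>A. inverse (a i)) \<in> S"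
    and inj: "inj_on \<phi> S"
begin

lemma mult_entrywise_group:
  assumes "a \<in> S" "b \<in> S"
  shows "\<phi> a \<otimes>\<^bsub>entrywise_group A S \<phi>\<^esub> \<phi> b = \<phi> (\<lambda>i\<in>A. a i * b i)"
  unfolding entrywise_group_def
  by (simp, rule the_equality) (use assms inj in \<open>auto dest: inj_onD\<close>)

lemma group_entrywise_group: "group (entrywise_group A S \<phi>)" (is "group ?G")
proof (rule groupI)
  have carr: "carrier ?G = \<phi> ` S" and one: "\<one>\<^bsub>?G\<^esub> = \<phi> (\<lambda>i\<in>A. 1)"
    by (simp_all add: entrywise_group_def)
  show "x \<otimes>\<^bsub>?G\<^esub> y \<in> carrier ?G" if "x \<in> carrier ?G" "y \<in> carrier ?G" for x y
    using that by (auto simp: carr mult_entrywise_group mult_mem)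
  show "\<one>\<^bsub>?G\<^esub> \<in> carrier ?G"
    by (simp add: carr one one_mem)
  show "x \<otimes>\<^bsub>?G\<^esub> y \<otimes>\<^bsub>?G\<^esub> z = x \<otimes>\<^bsub>?G\<^esub> (y \<otimes>\<^bsub>?G\<^esub> z)"
    if "x \<in> carrier ?G" "y \<in> carrier ?G" "z \<in> carrier ?G" for x y z
    using that
    by (auto simp: carr mult_entrywise_group mult_mem mult.assoc
        intro!: arg_cong[of _ _ \<phi>] restrict_ext)
  show "\<one>\<^bsub>?G\<^esub> \<otimes>\<^bsub>?G\<^esub> x = x" if "x \<in> carrier ?G" for x
  proof -
    from that obtain a where a: "a \<in> S" "x = \<phi> a" by (auto simp: carr)
    then have "(\<lambda>i\<in>A. (\<lambda>i\<in>A. 1) i * a i) = a"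
      using ext by (intro extensionalityI[of _ A]) auto
    then show ?thesis using a by (simp add: one one_mem mult_entrywise_group)
  qed
  show "\<exists>y\<in>carrier ?G. y \<otimes>\<^bsub>?G\<^esub> x = \<one>\<^bsub>?G\<^esub>" if "x \<in> carrier ?G" for x
  proof -
    from that obtain a where a: "a \<in> S" "x = \<phi> a" by (auto simp: carr)
    let ?b = "\<lambda>i\<in>A. inverse (a i)"
    have "(\<lambda>i\<in>A. ?b i * a i) = (\<lambda>i\<in>A. 1)"
      using nonzero[OF a(1)] by (intro restrict_ext) auto
    then have "\<phi> ?b \<otimes>\<^bsub>?G\<^esub> x = \<one>\<^bsub>?G\<^esub>"
      using mult_entrywise_group[OF inverse_mem[OF a(1)] a(1)] a by (simp only: one)
    then show ?thesis
      using inverse_mem[OF a(1)] unfolding carr by blast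
  qed
qed

end

lemma iso_entrywise_group:
  assumes "entrywise_families A S \<phi>" "entrywise_families A S \<psi>"
  shows "entrywise_group A S \<phi> \<cong> entrywise_group A S \<psi>"
proof -
  interpret phi: entrywise_families A S \<phi> by fact
  interpret psi: entrywise_families A S \<psi> by fact
  let ?h = "\<lambda>x. \<psi> (the_inv_into S \<phi> x)"
  have h: "?h (\<phi> a) = \<psi> a" if "a \<in> S" for a
    using that phi.inj by (simp add: the_inv_into_f_f)
  have c: "carrier (entrywise_group A S \<phi>) = \<phi> ` S" "carrier (entrywise_group A S \<psi>) = \<psi> ` S"
    by (simp_all add: entrywise_group_def)
  have "?h \<in> iso (entrywise_group A S \<phi>) (entrywise_group A S \<psi>)"
  proof (rule isoI)
    show "?h \<in> hom (entrywise_group A S \<phi>) (entrywise_group A S \<psi>)"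
      by (rule homI)
         (auto simp: c h phi.mult_entrywise_group psi.mult_entrywise_group phi.mult_mem)
    have "inj_on ?h (\<phi> ` S)"
      using psi.inj by (auto simp: inj_on_def h)
    moreover have "?h ` \<phi> ` S = \<psi> ` S"
      by (force simp: image_image h)
    ultimately show "bij_betw ?h (carrier (entrywise_group A S \<phi>)) (carrier (entrywise_group A S \<psi>))"
      by (simp add: bij_betw_def c)
  qed
  then show ?thesis by (rule is_isoI)
qed

section \<open>Tableaux and their one-column factors\<close>

lemma semistandard_rows: "semistandard (rows T)"
  using rows[of T] by simp

lemma row_count_star_rows:
  "(if i < length (star_rows R S) then count_list (star_rows R S ! i) j else 0) =
    (if i < length R then count_list (R ! i) j else 0) +
    (if i < length S then count_list (S ! i) j else 0)"
proof (induction R S arbitrary: i rule: star_rows.induct)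
  case (3 r R s S)
  note IH = "3.IH"
  have "count_list (sort (r @ s)) j = count_list r j + count_list s j"
    by (simp flip: count_mset)
  then show ?case using IH[of "i - 1"] by (cases i; simp only: diff_Suc_1 star_rows.simps length_Cons nth_Cons_Suc Suc_less_eq nth_Cons_0) simp
qed simp_all

lemma wt_add: "wt i j (S + T) = wt i j S + wt i j T"
  using row_count_star_rows[of "i - 1" "rows S" "rows T" j]
  by (cases i) (auto simp: wt_def plus_tableau.rep_eq Suc_le_eq)

lemma wt_zero: "wt i j 0 = 0"
  by (simp add: wt_def zero_tableau.rep_eq)

text \<open>This characterization makes closure under \<open>\<star>\<close> a consequence of the additivity of the weight.\<close>

lemma SSYT_iff_wt: "T \<in> SSYT n m \<longleftrightarrow> (\<forall>i j. wt i j T > 0 \<longrightarrow> i \<le> n \<and> j \<le> m)"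
proof
  assume T: "T \<in> SSYT n m"
  show "\<forall>i j. wt i j T > 0 \<longrightarrow> i \<le> n \<and> j \<le> m"
  proof (intro allI impI)
    fix i j assume "wt i j T > 0"
    then have "1 \<le> i" "i \<le> length (rows T)" "j \<in> set (rows T ! (i - 1))"
      using count_list_0_iff[of "rows T ! (i - 1)" j] by (auto simp: wt_def split: if_splits)
    then show "i \<le> n \<and> j \<le> m"
      using T nth_mem[of "i - 1" "rows T"] by (fastforce simp: SSYT_def)
  qed
next
  assume w: "\<forall>i j. wt i j T > 0 \<longrightarrow> i \<le> n \<and> j \<le> m"
  have *: "i < n \<and> a \<le> m" if "i < length (rows T)" "a \<in> set (rows T ! i)" for i a
  proof -
    have "wt (Suc i) a T > 0"
      using that count_list_0_iff[of "rows T ! i" a] by (simp add: wt_def Suc_le_eq)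
    then show ?thesis using w[rule_format, of "Suc i" a] by simp
  qed
  have "length (rows T) \<le> n"
  proof (cases "rows T")
    case (Cons r R)
    define l where "l = length (rows T) - 1"
    have l: "l < length (rows T)" "length (rows T) = Suc l" using Cons by (simp_all add: l_def)
    then have "rows T ! l \<noteq> []"
      using semistandard_rows[of T] nth_mem[of l "rows T"] unfolding semistandard_def by blast
    then obtain a where "a \<in> set (rows T ! l)" by (meson list.set_sel(1))
    then show ?thesis using *[of l a] l by simp
  qed simp
  moreover have "a \<le> m" if "r \<in> set (rows T)" "a \<in> set r" for r a
    using that * by (metis in_set_conv_nth)
  ultimately show "T \<in> SSYT n m" by (auto simp: SSYT_def)
qed

lemma additive_submonoid_SSYT: "additive_submonoid (SSYT n m)"
  by standard (auto simp: SSYT_iff_wt wt_add wt_zero)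

definition column_entries :: "nat \<Rightarrow> nat \<Rightarrow> nat list \<Rightarrow> bool" where
  "column_entries n m as \<longleftrightarrow> sorted_wrt (<) as \<and> set as \<subseteq> {1..m} \<and> length as \<le> n"

lemma semistandard_singletons_iff:
  "semistandard (map (\<lambda>a. [a]) as) \<longleftrightarrow> sorted_wrt (<) as \<and> 0 \<notin> set as"
proof -
  have "column_strict [a] [b] \<longleftrightarrow> a < b" for a b
    by (simp add: column_strict_def)
  then have "successively column_strict (map (\<lambda>a. [a]) as) \<longleftrightarrow> sorted_wrt (<) as"
    by (simp add: successively_map successively_conv_sorted_wrt)
  moreover have "(\<forall>a\<in>set as. a \<noteq> 0) \<longleftrightarrow> 0 \<notin> set as" by metis
  ultimately show ?thesis by (auto simp: semistandard_def)
qed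

lemma rows_column:
  "column_entries n m as \<Longrightarrow> rows (column as) = map (\<lambda>a. [a]) as"
  unfolding column_def
  by (rule Tableau_inverse) (auto simp: semistandard_singletons_iff column_entries_def)

lemma wt_column:
  assumes "column_entries n m as"
  shows "wt i j (column as) = (if 1 \<le> i \<and> i \<le> length as \<and> as ! (i - 1) = j then 1 else 0)"
  by (auto simp: wt_def rows_column[OF assms])

lemma column_inject:
  assumes "column_entries n m as" "column_entries n' m' bs" "column as = column bs"
  shows "as = bs"
  using arg_cong[OF assms(3), of "\<lambda>T. map hd (rows T)"]
  by (simp add: rows_column[OF assms(1)] rows_column[OF assms(2)] comp_def)

lemma semistandard_Cons:
  "semistandard (r # R) \<longleftrightarrow> r \<noteq> [] \<and> sorted r \<and> 0 \<notin> set r \<and> semistandard R \<and>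
    (R = [] \<or> column_strict r (hd R))"
  by (auto simp: semistandard_def successively_Cons)

text \<open>In particular no row is longer than the first one, so that a tableau whose first row has
  length \<open>1\<close> is a single column.\<close>

lemma semistandard_length_le:
  "semistandard (r # R) \<Longrightarrow> s \<in> set R \<Longrightarrow> length s \<le> length r"
proof (induction R arbitrary: r)
  case (Cons q R)
  then have "length q \<le> length r" "semistandard (q # R)"
    by (simp_all add: semistandard_Cons column_strict_def)
  then show ?case using Cons.IH[of q] Cons.prems by fastforce
qed simp

lemma G_cols_eq: "G_cols n m = column ` {as. column_entries n m as \<and> as \<noteq> []}"
proof (intro equalityI subsetI)
  fix T assume "T \<in> G_cols n m"
  then have T: "T \<in> SSYT n m" "num_columns T = 1" by (simp_all add: G_cols_def)
  then obtain r R where R: "rows T = r # R" "length r = 1"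
    by (cases "rows T") (auto simp: num_columns_def)
  have ss: "semistandard (r # R)" using semistandard_rows[of T] R by simp
  define as where "as = map hd (rows T)"
  have one: "[hd s] = s" if "s \<in> set (rows T)" for s
  proof -
    have "length s \<le> 1" "s \<noteq> []"
      using that ss R semistandard_length_le[OF ss, of s] by (auto simp: semistandard_def)
    then show ?thesis by (cases s) auto
  qed
  have rows: "rows T = map (\<lambda>a. [a]) as"
    by (simp add: as_def comp_def one map_idI)
  have "column as = T"
    by (simp add: column_def rows_inverse flip: rows)
  moreover have "column_entries n m as"
    using semistandard_rows[of T] T(1) rows
    by (auto simp: column_entries_def SSYT_def semistandard_singletons_iff Suc_le_eq intro: gr0I)
  moreover have "as \<noteq> []" by (simp add: as_def R)
  ultimately show "T \<in> column ` {as. column_entries n m as \<and> as \<noteq> []}" by blast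
next
  fix T assume "T \<in> column ` {as. column_entries n m as \<and> as \<noteq> []}"
  then obtain as where as: "column_entries n m as" "as \<noteq> []" "T = column as" by blast
  then show "T \<in> G_cols n m"
    by (auto simp: G_cols_def SSYT_def num_columns_def rows_column[OF as(1)] hd_map)
       (auto simp: column_entries_def)
qed

lemma G_colsE:
  assumes "T \<in> G_cols n m"
  obtains as where "column_entries n m as" "as \<noteq> []" "T = column as"
  using assms by (auto simp: G_cols_eq)

lemma column_mem_G_cols: "column_entries n m as \<Longrightarrow> as \<noteq> [] \<Longrightarrow> column as \<in> G_cols n m"
  by (auto simp: G_cols_eq)

section \<open>Peeling off the first column\<close>

abbreviation first_column_rows :: "nat list list \<Rightarrow> nat list list" where
  "first_column_rows R \<equiv> map (\<lambda>r. [hd r]) R"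

abbreviation remaining_rows :: "nat list list \<Rightarrow> nat list list" where
  "remaining_rows R \<equiv> filter (\<lambda>r. r \<noteq> []) (map tl R)"

text \<open>Removing the first column empties exactly the rows of length \<open>1\<close>.  These form a final segment,
  so dropping them keeps the other rows in place.\<close>

lemma remaining_rows_empty:
  assumes "semistandard (r # R)" "tl r = []"
  shows "remaining_rows R = []"
proof -
  have "tl s = []" if "s \<in> set R" for s
    using semistandard_length_le[OF assms(1) that] assms(2)
    by (metis Nil_tl diff_le_mono le_zero_eq length_0_conv length_tl)
  then show ?thesis by (simp add: filter_empty_conv)
qed

lemma semistandard_first_column_rows: "semistandard R \<Longrightarrow> semistandard (first_column_rows R)"
proof (induction R)
  case (Cons r R)
  then have R: "semistandard R" "r \<noteq> []" "0 \<notin> set r" "R = [] \<or> column_strict r (hd R)"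
    by (simp_all add: semistandard_Cons)
  have "hd r < hd (hd R)" if "R \<noteq> []"
  proof -
    have "hd R \<noteq> []" using R(1) that by (cases R) (auto simp: semistandard_Cons)
    then show ?thesis using R that by (auto simp: column_strict_def hd_conv_nth)
  qed
  moreover have "hd r \<noteq> 0" using R(2,3) by (metis list.set_sel(1))
  ultimately show ?case
    using Cons.IH R by (auto simp: semistandard_Cons column_strict_def hd_map)
qed simp

lemma semistandard_remaining_rows: "semistandard R \<Longrightarrow> semistandard (remaining_rows R)"
proof (induction R)
  case (Cons r R)
  then have R: "semistandard R" "sorted r" "0 \<notin> set r" "R = [] \<or> column_strict r (hd R)"
    by (simp_all add: semistandard_Cons)
  show ?case
  proof (cases "tl r = []")
    case True
    then show ?thesis
      using remaining_rows_empty[OF Cons.prems] by (simp add: semistandard_def)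
  next
    case False
    have "column_strict (tl r) (hd (remaining_rows R))" if "remaining_rows R \<noteq> []"
    proof (cases R)
      case (Cons s S)
      have "tl s \<noteq> []"
        using remaining_rows_empty[of s S] R(1) that Cons by auto
      moreover have "column_strict (tl r) (tl s)"
        using R(4) Cons by (auto simp: column_strict_def nth_tl)
      ultimately show ?thesis using Cons by simp
    qed (use that in simp)
    moreover have "0 \<notin> set (tl r)" using R(3) by (cases r) auto
    ultimately show ?thesis
      using False Cons.IH R by (auto simp: semistandard_Cons sorted_tl)
  qed
qed simp

lemma star_rows_peel:
  "semistandard R \<Longrightarrow> star_rows (first_column_rows R) (remaining_rows R) = R"
proof (induction R)
  case (Cons r R)
  then have R: "semistandard R" "sorted r" "r \<noteq> []" by (simp_all add: semistandard_Cons)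
  show ?case
  proof (cases "tl r = []")
    case True
    have "remaining_rows R = []" by (rule remaining_rows_empty[OF Cons.prems True])
    moreover have "[hd r] = r" using True R by (cases r) auto
    ultimately show ?thesis using Cons.IH R True by simp
  next
    case False
    have "sort ([hd r] @ tl r) = r" using R by (simp add: sorted_sort_id)
    then show ?thesis using False Cons.IH R by simp
  qed
qed simp

text \<open>One-column tableaux generate the monoid: peeling off the first column leaves a tableau with
  fewer columns.\<close>

lemma SSYT_column_induct [consumes 1, case_names zero add]:
  assumes "T \<in> SSYT n m"
    and "P 0"
    and step: "\<And>C T. C \<in> G_cols n m \<Longrightarrow> T \<in> SSYT n m \<Longrightarrow> P T \<Longrightarrow> P (C + T)"
  shows "P T"
  using assms(1)
proof (induction "num_columns T" arbitrary: T rule: less_induct)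
  case less
  show ?case
  proof (cases "rows T")
    case Nil
    then have "T = 0" by (simp add: rows_inject[symmetric] zero_tableau.rep_eq)
    then show ?thesis using assms(2) by simp
  next
    case (Cons r R)
    have ss: "semistandard (rows T)" by (rule semistandard_rows)
    define C where "C = Tableau (first_column_rows (rows T))"
    define T' where "T' = Tableau (remaining_rows (rows T))"
    have rows: "rows C = first_column_rows (rows T)" "rows T' = remaining_rows (rows T)"
      by (simp_all add: C_def T'_def Tableau_inverse semistandard_first_column_rows
          semistandard_remaining_rows ss)
    have T: "T = C + T'"
      by (simp add: rows_inject[symmetric] plus_tableau.rep_eq rows star_rows_peel ss)
    have "C \<in> G_cols n m" "T' \<in> SSYT n m"
      using less.prems Cons
      by (auto simp: G_cols_def SSYT_iff_wt num_columns_def rows T wt_add)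
    moreover have "num_columns T' < num_columns T"
    proof -
      have len: "length s < length r" if s: "s \<in> set (rows T')" for s
      proof -
        obtain q where q: "q \<in> set (rows T)" "s = tl q" "s \<noteq> []"
          using s unfolding rows by auto
        then have "length q \<le> length r"
          using semistandard_length_le[of r R q] ss Cons by auto
        moreover have "length s < length q" using q(2,3) by (cases q) simp_all
        ultimately show ?thesis by simp
      qed
      show ?thesis
      proof (cases "rows T' = []")
        case True
        then show ?thesis using Cons ss by (simp add: num_columns_def semistandard_Cons)
      next
        case False
        then show ?thesis using len[OF list.set_sel(1)] Cons by (simp add: num_columns_def)
      qed
    qed
    ultimately show ?thesis
      using step less.hyps T by metis
  qed
qed

section \<open>Product relations\<close>

text \<open>Above their last rows both products have the same rows, and the only entry of the next row is
  \<open>x\<close>.\<close>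

lemma add_columns_move_last:
  assumes "column_entries n m (as @ [x])" "column_entries n m as"
    and "column_entries n m (bs @ [x])" "column_entries n m bs"
    and "length as = length bs"
  shows "column (as @ [x]) + column bs = column as + column (bs @ [x])"
proof -
  have *: "star_rows (map (\<lambda>a. [a]) (as @ [x])) (map (\<lambda>a. [a]) bs) =
      star_rows (map (\<lambda>a. [a]) as) (map (\<lambda>a. [a]) bs) @ [[x]]"
    if "length as = length bs" for as bs :: "nat list"
    using that by (induction as bs rule: list_induct2) auto
  have "star_rows (map (\<lambda>a. [a]) (as @ [x])) (map (\<lambda>a. [a]) bs) =
      star_rows (map (\<lambda>a. [a]) as) (map (\<lambda>a. [a]) (bs @ [x]))"
    using *[of as bs] *[of bs as] assms(5) star_rows_commute by metis
  then show ?thesis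
    using assms by (simp add: rows_inject[symmetric] plus_tableau.rep_eq rows_column)
qed

text \<open>Row \<open>i\<close> of a product contains the entries of both factors and nothing else.  This is all that is
  needed to see which columns can occur in a product relation.\<close>

lemma add_columns_nth:
  assumes "column_entries n m as" "column_entries n m cs" "column_entries n m es"
    and "column as + T = column cs + column es" and "i < length as"
  shows "\<exists>ds\<in>{cs, es}. i < length ds \<and> ds ! i = as ! i"
proof -
  have "wt (Suc i) (as ! i) (column cs) + wt (Suc i) (as ! i) (column es) > 0"
    using arg_cong[OF assms(4), of "wt (Suc i) (as ! i)"] assms(5) wt_column[OF assms(1)]
    by (simp add: wt_add del: add_gr_0)
  then show ?thesis
    by (auto simp: wt_column[OF assms(2)] wt_column[OF assms(3)] split: if_splits)
qed

lemma strictly_sorted_nth_add: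
  fixes as :: "nat list"
  assumes "sorted_wrt (<) as"
  shows "i + d < length as \<Longrightarrow> as ! i + d \<le> as ! (i + d)"
proof (induction d)
  case (Suc d)
  then have "as ! (i + d) < as ! (i + Suc d)"
    using assms by (simp add: sorted_wrt_iff_nth_less)
  then show ?case using Suc by simp
qed simp

lemma column_entries_nth_ge:
  assumes "column_entries n m as" "i < length as"
  shows "Suc i \<le> as ! i"
proof -
  have "as ! 0 \<in> set as" using assms(2) by (intro nth_mem) linarith
  then have "1 \<le> as ! 0" using assms(1) by (auto simp: column_entries_def)
  then show ?thesis
    using strictly_sorted_nth_add[of as 0 i] assms by (simp add: column_entries_def)
qed

text \<open>Between the lower bound of each entry by its position and a tight later entry there is no
  room left.\<close>

lemma column_entries_take_initial:
  assumes "column_entries n m as" "k \<le> length as" "1 \<le> k" "as ! (k - 1) = k"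
  shows "take k as = [1..<Suc k]"
proof (rule nth_equalityI)
  fix i assume "i < length (take k as)"
  then have i: "i < k" by simp
  then have "as ! i + (k - 1 - i) \<le> k"
    using strictly_sorted_nth_add[of as i "k - 1 - i"] assms by (simp add: column_entries_def)
  then have "as ! i = Suc i"
    using column_entries_nth_ge[OF assms(1), of i] i assms(2) by simp
  then show "take k as ! i = [1..<Suc k] ! i" using i by (simp del: upt_Suc)
qed (use assms in simp)

lemma column_entries_initial: "k \<le> n \<Longrightarrow> n \<le> m \<Longrightarrow> column_entries n m [1..<Suc k]"
  by (auto simp: column_entries_def simp del: upt_Suc)

lemma relation_initial_column:
  assumes "1 \<le> k" "k \<le> n" "n \<le> m" "column_entries n m cs" "column_entries n m es"
    and "column [1..<Suc k] + b = column cs + column es"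
  shows "\<exists>ds\<in>{cs, es}. k \<le> length ds \<and> take k ds = [1..<Suc k]"
proof -
  have "\<exists>ds\<in>{cs, es}. k - 1 < length ds \<and> ds ! (k - 1) = [1..<Suc k] ! (k - 1)"
    using assms by (intro add_columns_nth[OF column_entries_initial]) (simp_all del: upt_Suc)
  moreover have "[1..<Suc k] ! (k - 1) = k" using assms(1) by (simp del: upt_Suc)
  ultimately obtain ds where ds: "ds \<in> {cs, es}" "k - 1 < length ds" "ds ! (k - 1) = k"
    by metis
  then have "k \<le> length ds" by linarith
  moreover have "column_entries n m ds" using ds(1) assms by auto
  ultimately have "take k ds = [1..<Suc k]"
    using assms(1) ds(3) by (intro column_entries_take_initial)
  with ds(1) \<open>k \<le> length ds\<close> show ?thesis by blast
qed

text \<open>If the full column \<open>[1, \<dots>, n]\<close> were a factor, then some factor on the other side would begin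
  with it, and equal it since columns have height at most \<open>n\<close>.\<close>

lemma relation_not_full_column:
  assumes nm: "1 \<le> n" "n \<le> m"
    and "c \<in> G_cols n m" "e \<in> G_cols n m" "a \<noteq> c" "a \<noteq> e" "a + b = c + e"
  shows "a \<noteq> column [1..<Suc n]"
proof
  assume a: "a = column [1..<Suc n]"
  obtain cs es where cs: "column_entries n m cs" "c = column cs"
    and es: "column_entries n m es" "e = column es"
    using assms by (metis G_colsE)
  obtain ds where ds: "ds \<in> {cs, es}" "n \<le> length ds" "take n ds = [1..<Suc n]"
    using relation_initial_column[of n n m cs es b] nm cs es assms a by auto
  then have "ds = [1..<Suc n]" using cs es by (auto simp: column_entries_def)
  then show False using ds(1) a assms cs es by auto
qed

text \<open>A column with \<open>m\<close> in its first row has no room for a second row.\<close>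

lemma relation_not_bottom_column:
  assumes nm: "1 \<le> n" "n \<le> m"
    and "c \<in> G_cols n m" "e \<in> G_cols n m" "a \<noteq> c" "a \<noteq> e" "a + b = c + e"
  shows "a \<noteq> column [m]"
proof
  assume a: "a = column [m]"
  obtain cs es where cs: "column_entries n m cs" "c = column cs"
    and es: "column_entries n m es" "e = column es"
    using assms by (metis G_colsE)
  have "column_entries n m [m]" using nm by (simp add: column_entries_def)
  then obtain ds where ds: "ds \<in> {cs, es}" "0 < length ds" "ds ! 0 = m"
    using add_columns_nth[of n m "[m]" cs es b 0] cs es assms a by auto
  have ent: "column_entries n m ds" using ds(1) cs es by auto
  have "length ds = 1"
  proof (rule ccontr)
    assume "length ds \<noteq> 1"
    then have "1 < length ds" using ds(2) by linarith
    then have "ds ! 0 + 1 \<le> ds ! 1" "ds ! 1 \<in> set ds"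
      using strictly_sorted_nth_add[of ds 0 1] ent by (simp_all add: column_entries_def)
    then show False using ds(3) ent by (auto simp: column_entries_def)
  qed
  then have "ds = [m]" using ds(3) by (cases ds) auto
  then show False using ds(1) a assms cs es by auto
qed

text \<open>For \<open>m = n\<close> a column that begins with \<open>1, \<dots>, n - 1\<close> either stops there or is the full column,
  which has been excluded already.\<close>

lemma relation_not_almost_full_column:
  assumes n: "2 \<le> n"
    and ab: "a \<in> G_cols n n" "b \<in> G_cols n n"
    and ce: "c \<in> G_cols n n" "e \<in> G_cols n n"
    and rel: "distinct [a, b, c, e]" "a + b = c + e"
  shows "a \<noteq> column [1..<n]"
proof
  assume a: "a = column [1..<n]"
  obtain cs es where cs: "column_entries n n cs" "c = column cs"
    and es: "column_entries n n es" "e = column es"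
    using ce by (metis G_colsE)
  obtain ds where ds: "ds \<in> {cs, es}" "n - 1 \<le> length ds" "take (n - 1) ds = [1..<n]"
  proof -
    have "Suc (n - 1) = n" using n by simp
    then have "\<exists>ds\<in>{cs, es}. n - 1 \<le> length ds \<and> take (n - 1) ds = [1..<n]"
      using relation_initial_column[of "n - 1" n n cs es b] n cs es rel a by simp
    then show ?thesis using that by blast
  qed
  have ent: "column_entries n n ds" using ds(1) cs es by auto
  show False
  proof (cases "length ds = n")
    case True
    then have "ds ! (n - 1) \<in> set ds" using n by (intro nth_mem) simp
    then have "ds ! (n - 1) \<le> n" using ent unfolding column_entries_def by auto
    then have "ds ! (n - 1) = n"
      using column_entries_nth_ge[OF ent, of "n - 1"] True n by simp
    then have "ds = [1..<Suc n]"
      using column_entries_take_initial[OF ent, of n] True n by simp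
    moreover have "c \<noteq> column [1..<Suc n]"
      using n ab rel by (intro relation_not_full_column[of n n a b c e]) auto
    moreover have "e \<noteq> column [1..<Suc n]"
      using n ab rel add.commute[of c e] by (intro relation_not_full_column[of n n a b e c]) auto
    ultimately show False using ds(1) cs es by auto
  next
    case False
    then have "length ds = n - 1" using ds(2) ent unfolding column_entries_def by linarith
    then have "ds = [1..<n]" using ds(3) by simp
    then show False using ds(1) a cs es rel by auto
  qed
qed

lemma relation_mem_E_cols:
  assumes "1 \<le> n" "n \<le> m" "{a, b, c, e} \<subseteq> G_cols n m" "distinct [a, b, c, e]" "a + b = c + e"
  shows "a \<in> E_cols n m"
proof -
  have "a \<notin> F_cols n m"
    using relation_not_full_column[of n m c e a b] relation_not_bottom_column[of n m c e a b]
      relation_not_almost_full_column[of n a b c e] assms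
    unfolding F_cols_def by (auto split: if_splits simp del: upt_Suc)
  then show ?thesis using assms by (simp add: E_cols_def)
qed

lemma relation_subset_E_cols:
  assumes "1 \<le> n" "n \<le> m" "{a, b, c, e} \<subseteq> G_cols n m" "distinct [a, b, c, e]" "a + b = c + e"
  shows "{a, b, c, e} \<subseteq> E_cols n m"
proof -
  have comm: "b + a = c + e" "c + e = a + b" "e + c = a + b"
    using assms(5) by (simp_all only: add.commute)
  have "a \<in> E_cols n m" "b \<in> E_cols n m" "c \<in> E_cols n m" "e \<in> E_cols n m"
    using relation_mem_E_cols[OF assms(1,2) _ _ assms(5)]
      relation_mem_E_cols[OF assms(1,2) _ _ comm(1)]
      relation_mem_E_cols[OF assms(1,2) _ _ comm(2)]
      relation_mem_E_cols[OF assms(1,2) _ _ comm(3)] assms(3,4) by auto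
  then show ?thesis by simp
qed

text \<open>Because the relations live in the variables \<open>E\<close>, a point is a family on all columns that
  respects every product relation.\<close>

lemma points_iff:
  fixes t :: "tableau \<Rightarrow> 'k::comm_ring_1"
  assumes nm: "1 \<le> n" "n \<le> m"
  shows "t \<in> points n m \<longleftrightarrow> t \<in> extensional (G_cols n m) \<and>
    (\<forall>a b c e. {a, b, c, e} \<subseteq> G_cols n m \<longrightarrow> distinct [a, b, c, e] \<longrightarrow> a + b = c + e \<longrightarrow>
      t a * t b = t c * t e)"
proof -
  let ?E = "E_cols n m"
  have sub: "product_relations n m \<subseteq> (carrier (poly_ring ?E) :: (tableau, 'k) polynomial set)"
  proof
    fix p :: "(tableau, 'k) polynomial" assume "p \<in> product_relations n m"
    then obtain a b c e where "p = var a * var b - var c * var e"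
      and rel: "{a, b, c, e} \<subseteq> G_cols n m" "distinct [a, b, c, e]" "a + b = c + e"
      unfolding product_relations_def by blast
    then show "p \<in> carrier (poly_ring ?E)"
      using poly_eval_binomial(1)[OF relation_subset_E_cols[OF nm rel]] by simp
  qed
  have eval: "poly_eval ?E (restrict t ?E) (var a * var b - var c * var e) = t a * t b - t c * t e"
    if "{a, b, c, e} \<subseteq> G_cols n m" "distinct [a, b, c, e]" "a + b = c + e" for a b c e
    using poly_eval_binomial(2)[OF relation_subset_E_cols[OF nm that], of "restrict t ?E"]
      relation_subset_E_cols[OF nm that] by simp
  have "restrict t ?E \<in> zero_locus ?E (\<P> n m) \<longleftrightarrow>
      (\<forall>p\<in>product_relations n m. poly_eval ?E (restrict t ?E) p = 0)"
    unfolding \<P>_def zero_locus_genideal[OF sub] by (simp add: zero_locus_def)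
  also have "\<dots> \<longleftrightarrow> (\<forall>a b c e. {a, b, c, e} \<subseteq> G_cols n m \<longrightarrow> distinct [a, b, c, e] \<longrightarrow>
      a + b = c + e \<longrightarrow> t a * t b = t c * t e)" (is "?L \<longleftrightarrow> ?R")
  proof
    assume L: ?L
    show ?R
    proof (intro allI impI)
      fix a b c e
      assume rel: "{a, b, c, e} \<subseteq> G_cols n m" "distinct [a, b, c, e]" "a + b = c + e"
      then have "var a * var b - var c * var e \<in> (product_relations n m :: (tableau, 'k) polynomial set)"
        unfolding product_relations_def by blast
      then have "poly_eval ?E (restrict t ?E) (var a * var b - var c * var e) = 0"
        using L by blast
      then show "t a * t b = t c * t e" unfolding eval[OF rel] by simp
    qed
  next
    assume R: ?R
    show ?L
    proof
      fix p :: "(tableau, 'k) polynomial" assume "p \<in> product_relations n m"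
      then obtain a b c e where p: "p = var a * var b - var c * var e"
        and rel: "{a, b, c, e} \<subseteq> G_cols n m" "distinct [a, b, c, e]" "a + b = c + e"
        unfolding product_relations_def by blast
      then have "t a * t b = t c * t e" using R by blast
      then show "poly_eval ?E (restrict t ?E) p = 0" using eval[OF rel] p by simp
    qed
  qed
  finally show ?thesis by (simp add: points_def PiE_def)
qed

section \<open>Evaluation characters on tableaux\<close>

definition tableau_char :: "nat \<Rightarrow> nat \<Rightarrow> (nat \<times> nat \<Rightarrow> 'k::comm_ring_1) \<Rightarrow> tableau \<Rightarrow> 'k" where
  "tableau_char n m \<alpha> T = (\<Prod>(i, j)\<in>X_vars n m. \<alpha> (i, j) ^ wt i j T)"

lemma tableau_ev_eq: "tableau_ev n m \<alpha> = linear_extension (SSYT n m) (tableau_char n m \<alpha>)"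
  by (simp add: tableau_ev_def tableau_char_def[abs_def])

lemma monoid_character_tableau_char: "monoid_character (SSYT n m) (tableau_char n m \<alpha>)"
proof -
  interpret additive_submonoid "SSYT n m" by (rule additive_submonoid_SSYT)
  show ?thesis
    by standard
       (simp_all add: tableau_char_def wt_zero wt_add power_add prod.distrib case_prod_beta)
qed

text \<open>A column has one entry in each of its rows, so each row contributes a single factor.\<close>

lemma tableau_char_column:
  assumes "column_entries n m as"
  shows "tableau_char n m \<alpha> (column as) = (\<Prod>i<length as. \<alpha> (Suc i, as ! i))"
proof -
  have as: "length as \<le> n" "\<And>i. i < length as \<Longrightarrow> as ! i \<in> {1..m}"
    using assms nth_mem[of _ as] unfolding column_entries_def by blast+
  have inner: "(\<Prod>j\<in>{1..m}. \<alpha> (Suc i, j) ^ wt (Suc i) j (column as)) =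
      (if i < length as then \<alpha> (Suc i, as ! i) else 1)" for i
  proof (cases "i < length as")
    case True
    have "(\<Prod>j\<in>{1..m}. \<alpha> (Suc i, j) ^ wt (Suc i) j (column as)) =
        (\<Prod>j\<in>{1..m}. if as ! i = j then \<alpha> (Suc i, j) else 1)"
      using True by (intro prod.cong) (simp_all add: wt_column[OF assms])
    then show ?thesis using True as(2)[OF True] by simp
  qed (simp add: wt_column[OF assms])
  have "tableau_char n m \<alpha> (column as) =
      (\<Prod>i\<in>{1..n}. \<Prod>j\<in>{1..m}. \<alpha> (i, j) ^ wt i j (column as))"
    by (simp add: tableau_char_def X_vars_def prod.cartesian_product)
  also have "\<dots> = (\<Prod>i<n. \<Prod>j\<in>{1..m}. \<alpha> (Suc i, j) ^ wt (Suc i) j (column as))"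
    by (rule prod.reindex_bij_witness[of _ Suc "\<lambda>i. i - 1"]) auto
  also have "\<dots> = (\<Prod>i<n. if i < length as then \<alpha> (Suc i, as ! i) else 1)"
    by (simp only: inner)
  also have "\<dots> = (\<Prod>i<length as. \<alpha> (Suc i, as ! i))"
    using as(1) by (intro prod.mono_neutral_cong_right) auto
  finally show ?thesis .
qed

lemma \<Psi>_eq: "\<Psi> n m \<alpha> = (\<lambda>T\<in>G_cols n m. tableau_char n m \<alpha> T)"
proof -
  interpret monoid_character "SSYT n m" "tableau_char n m \<alpha>"
    by (rule monoid_character_tableau_char)
  show ?thesis
    unfolding \<Psi>_def tableau_ev_eq
    by (rule restrict_ext) (simp add: linear_extension_embed G_cols_def)
qed

text \<open>The generators of the ideal involve columns only, and columns generate the monoid.\<close>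

lemma M_ideal_\<Psi>:
  "M_ideal n m (\<Psi> n m \<alpha>) = {f \<in> carrier (\<T> n m). tableau_ev n m \<alpha> f = 0}"
proof -
  interpret monoid_character "SSYT n m" "tableau_char n m \<alpha>"
    by (rule monoid_character_tableau_char)
  have "{embed T - scalar (\<Psi> n m \<alpha> T) | T. T \<in> G_cols n m} =
      {embed T - scalar (tableau_char n m \<alpha> T) | T. T \<in> G_cols n m}"
    unfolding \<Psi>_eq by (rule Collect_cong, rule ex_cong1) auto
  then have "M_ideal n m (\<Psi> n m \<alpha>) = genideal (monoid_algebra (SSYT n m))
      {embed T - scalar (tableau_char n m \<alpha> T) | T. T \<in> G_cols n m}"
    by (simp only: M_ideal_def \<T>_def)
  also have "\<dots> = {f \<in> carrier (\<T> n m). tableau_ev n m \<alpha> f = 0}"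
    unfolding \<T>_def tableau_ev_eq
  proof (rule genideal_generators_eq_kernel)
    show "G_cols n m \<subseteq> SSYT n m" by (auto simp: G_cols_def)
    show "P T" if "T \<in> SSYT n m" "P 0"
      "\<And>C T. C \<in> G_cols n m \<Longrightarrow> T \<in> SSYT n m \<Longrightarrow> P T \<Longrightarrow> P (C + T)" for P T
      using that by (rule SSYT_column_induct)
  qed
  finally show ?thesis .
qed

lemma quot_map_\<Psi>: "quot_map n m (\<Psi> n m \<alpha>) = tableau_ev n m \<alpha>"
proof -
  interpret monoid_character "SSYT n m" "tableau_char n m \<alpha>"
    by (rule monoid_character_tableau_char)
  have "quot_map n m (\<Psi> n m \<alpha>) = (\<lambda>f\<in>carrier (\<T> n m). tableau_ev n m \<alpha> f)"
    unfolding quot_map_def M_ideal_\<Psi>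
    by (rule restrict_ext) (simp add: \<T>_def tableau_ev_eq kernel_coset_scalar_eq_iff)
  also have "\<dots> = tableau_ev n m \<alpha>"
    by (auto simp: tableau_ev_def \<T>_def linear_extension_def)
  finally show ?thesis .
qed

lemma quot_map_\<Psi>_embed:
  assumes "T \<in> G_cols n m"
  shows "quot_map n m (\<Psi> n m \<alpha>) (embed T) = \<Psi> n m \<alpha> T"
  unfolding quot_map_\<Psi> using assms by (simp add: \<Psi>_def)

section \<open>The points with nonzero coordinates\<close>

lemma \<Psi>_mem_points:
  assumes "1 \<le> n" "n \<le> m"
  shows "\<Psi> n m \<alpha> \<in> points n m"
proof -
  interpret monoid_character "SSYT n m" "tableau_char n m \<alpha>"
    by (rule monoid_character_tableau_char)
  have "tableau_char n m \<alpha> a * tableau_char n m \<alpha> b = tableau_char n m \<alpha> c * tableau_char n m \<alpha> e"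
    if "{a, b, c, e} \<subseteq> G_cols n m" "a + b = c + e" for a b c e
  proof -
    have G: "{a, b, c, e} \<subseteq> SSYT n m" using that(1) by (auto simp: G_cols_def)
    have "tableau_char n m \<alpha> a * tableau_char n m \<alpha> b = tableau_char n m \<alpha> (a + b)"
      using G by (intro char_add[symmetric]) simp_all
    also have "\<dots> = tableau_char n m \<alpha> (c + e)" by (simp only: that(2))
    also have "\<dots> = tableau_char n m \<alpha> c * tableau_char n m \<alpha> e"
      using G by (intro char_add) simp_all
    finally show ?thesis .
  qed
  then show ?thesis
    by (simp add: points_iff[OF assms] \<Psi>_eq)
qed

lemma \<Psi>_mem_J_pts:
  fixes \<alpha> :: "nat \<times> nat \<Rightarrow> 'k::field"
  assumes "1 \<le> n" "n \<le> m" "\<alpha> \<in> I_pts n m"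
  shows "\<Psi> n m \<alpha> \<in> J_pts n m"
proof -
  have "tableau_char n m \<alpha> T \<noteq> 0" for T
    using assms(3) by (auto simp: tableau_char_def I_pts_def X_vars_def)
  then show ?thesis
    using \<Psi>_mem_points[OF assms(1,2)] by (auto simp: J_pts_def \<Psi>_eq)
qed

text \<open>The product relation that exchanges the last entry of a column with the last entry of an
  initial column computes the value of a column from those of the columns \<open>[1, \<dots>, k, x]\<close>.  It
  degenerates when the two columns coincide, and then there is nothing to prove.\<close>

lemma J_pts_move_last:
  fixes t :: "tableau \<Rightarrow> 'k::field"
  assumes nm: "1 \<le> n" "n \<le> m" and t: "t \<in> J_pts n m"
    and as: "column_entries n m (as @ [x])" and ne: "as \<noteq> []"
  defines "bs \<equiv> [1..<Suc (length as)]"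
  shows "t (column (as @ [x])) * t (column bs) = t (column as) * t (column (bs @ [x]))"
proof (cases "as = bs")
  case False
  have as': "column_entries n m as"
    using as by (auto simp: column_entries_def sorted_wrt_append)
  have bs: "column_entries n m bs"
    unfolding bs_def using as nm by (intro column_entries_initial) (simp_all add: column_entries_def)
  have "Suc (length as) \<le> x"
    using column_entries_nth_ge[OF as, of "length as"] by simp
  then have bs': "column_entries n m (bs @ [x])"
    using as by (auto simp: column_entries_def bs_def sorted_wrt_append simp del: upt_Suc)
  have len: "length as = length bs" unfolding bs_def length_upt by simp
  have neq: "column cs \<noteq> column ds"
    if "column_entries n m cs" "column_entries n m ds" "cs \<noteq> ds" for cs ds
    using column_inject that by blast
  have "distinct [column (as @ [x]), column bs, column as, column (bs @ [x])]"
  proof -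
    have "as @ [x] \<noteq> bs" "as \<noteq> bs @ [x]" using len by auto
    then show ?thesis
      using False neq[OF as bs] neq[OF as as'] neq[OF as bs'] neq[OF as' bs] neq[OF bs bs']
        neq[OF as' bs'] by auto
  qed
  moreover have "{column (as @ [x]), column bs, column as, column (bs @ [x])} \<subseteq> G_cols n m"
    using as as' bs bs' ne len by (auto intro!: column_mem_G_cols)
  ultimately show ?thesis
    using t add_columns_move_last[OF as as' bs' bs len]
    unfolding J_pts_def mem_Collect_eq points_iff[OF nm] by blast
qed (simp add: mult.commute)

lemma I_pts_extend:
  fixes v :: "nat \<Rightarrow> nat \<Rightarrow> 'k::field"
  assumes "\<And>i j. 1 \<le> i \<Longrightarrow> i \<le> j \<Longrightarrow> i \<le> n \<Longrightarrow> j \<le> m \<Longrightarrow> v i j \<noteq> 0"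
  shows "(\<lambda>(i, j)\<in>X_vars n m. if i \<le> j then v i j else 1) \<in> I_pts n m"
  using assms by (auto simp: I_pts_def X_vars_def)

text \<open>A point with nonzero coordinates is determined by its values on the columns
  \<open>[1, \<dots>, i - 1, j]\<close>; the quotients of consecutive ones solve for \<open>\<alpha>\<close>.  The entries of \<open>\<alpha>\<close> with
  \<open>j < i\<close> never occur in a column and are set to \<open>1\<close>.\<close>

lemma J_pts_subset_range_\<Psi>:
  fixes t :: "tableau \<Rightarrow> 'k::field"
  assumes nm: "1 \<le> n" "n \<le> m" and t: "t \<in> J_pts n m"
  shows "\<exists>\<alpha>\<in>I_pts n m. t = \<Psi> n m \<alpha>"
proof -
  \<comment> \<open>\<open>\<tau>\<close> extends \<open>t\<close> by the value \<open>1\<close> at the empty column, so that the first row needs no special case\<close>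
  define \<tau> where "\<tau> = (\<lambda>as. if as = [] then 1 else t (column as))"
  define v where "v = (\<lambda>i j. \<tau> ([1..<i] @ [j]) / \<tau> [1..<i])"
  define \<alpha> where "\<alpha> = (\<lambda>(i, j)\<in>X_vars n m. if i \<le> j then v i j else 1)"
  have nz: "\<tau> as \<noteq> 0" if "column_entries n m as" for as
    using that t column_mem_G_cols[OF that] by (auto simp: \<tau>_def J_pts_def)
  have "v i j \<noteq> 0" if "1 \<le> i" "i \<le> j" "i \<le> n" "j \<le> m" for i j
  proof -
    have "column_entries n m ([1..<i] @ [j])" "column_entries n m [1..<i]"
      using that by (auto simp: column_entries_def sorted_wrt_append)
    then show ?thesis using nz by (simp add: v_def)
  qed
  then have \<alpha>: "\<alpha> \<in> I_pts n m" unfolding \<alpha>_def by (rule I_pts_extend)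
  have \<tau>: "\<tau> as = (\<Prod>i<length as. \<alpha> (Suc i, as ! i))" if "column_entries n m as" for as
    using that
  proof (induction as rule: rev_induct)
    case Nil
    then show ?case by (simp add: \<tau>_def)
  next
    case (snoc x as)
    let ?k = "length as" and ?bs = "[1..<Suc (length as)]"
    have as: "column_entries n m as" and k: "?k < n" and x: "x \<le> m"
      using snoc.prems by (auto simp: column_entries_def sorted_wrt_append)
    have kx: "Suc ?k \<le> x"
      using column_entries_nth_ge[OF snoc.prems, of ?k] by simp
    have "\<tau> ?bs \<noteq> 0"
      using k nm by (intro nz column_entries_initial) simp_all
    have "\<tau> (as @ [x]) * \<tau> ?bs = \<tau> as * \<tau> (?bs @ [x])"
    proof (cases "as = []")
      case False
      then show ?thesis
        using J_pts_move_last[OF nm t snoc.prems False] by (simp add: \<tau>_def del: upt_Suc)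
    qed simp
    then have "\<tau> (as @ [x]) = \<tau> as * v (Suc ?k) x"
      using \<open>\<tau> ?bs \<noteq> 0\<close> by (simp add: v_def field_simps del: upt_Suc)
    also have "v (Suc ?k) x = \<alpha> (Suc ?k, x)"
      using k x kx by (simp add: \<alpha>_def X_vars_def)
    also have "\<tau> as = (\<Prod>i<?k. \<alpha> (Suc i, (as @ [x]) ! i))"
      using snoc.IH[OF as] by (simp add: nth_append)
    finally show ?case by simp
  qed
  have "t = \<Psi> n m \<alpha>"
  proof (rule extensionalityI)
    show "t \<in> extensional (G_cols n m)"
      using t by (simp add: J_pts_def points_iff[OF nm])
    show "\<Psi> n m \<alpha> \<in> extensional (G_cols n m)" by (simp add: \<Psi>_eq)
    fix T assume T: "T \<in> G_cols n m"
    then obtain as where as: "column_entries n m as" "as \<noteq> []" "T = column as"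
      by (rule G_colsE)
    then show "t T = \<Psi> n m \<alpha> T"
      using T \<tau>[OF as(1)] by (simp add: \<Psi>_eq tableau_char_column \<tau>_def)
  qed
  with \<alpha> show ?thesis by blast
qed

lemma J_pts_eq_image:
  fixes n m :: nat
  assumes "1 \<le> n" "n \<le> m"
  shows "(J_pts n m :: (tableau \<Rightarrow> 'k::field) set) = \<Psi> n m ` I_pts n m"
  using J_pts_subset_range_\<Psi>[OF assms] \<Psi>_mem_J_pts[OF assms] by blast

text \<open>Comparing the values on \<open>[1, \<dots>, i - 1]\<close> and \<open>[1, \<dots>, i - 1, j]\<close> isolates \<open>\<alpha>\<^sub>i\<^sub>j\<close>.  Only
  indices with \<open>i \<le> j\<close> matter for the converse, because entries of columns are at least as large as
  their row numbers.\<close>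

lemma \<Psi>_eq_one_iff:
  fixes \<alpha> :: "nat \<times> nat \<Rightarrow> 'k::field"
  assumes nm: "1 \<le> n" "n \<le> m"
  shows "\<Psi> n m \<alpha> = (\<lambda>T\<in>G_cols n m. 1) \<longleftrightarrow> (\<forall>(i, j)\<in>X_vars n m. i \<le> j \<longrightarrow> \<alpha> (i, j) = 1)"
proof
  assume one: "\<Psi> n m \<alpha> = (\<lambda>T\<in>G_cols n m. 1)"
  have prod: "(\<Prod>i<length as. \<alpha> (Suc i, as ! i)) = 1" if "column_entries n m as" for as
  proof (cases "as = []")
    case False
    have "\<Psi> n m \<alpha> (column as) = 1"
      using one column_mem_G_cols[OF that False] by simp
    then show ?thesis
      using column_mem_G_cols[OF that False] by (simp add: \<Psi>_eq tableau_char_column[OF that])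
  qed simp
  show "\<forall>(i, j)\<in>X_vars n m. i \<le> j \<longrightarrow> \<alpha> (i, j) = 1"
  proof (clarify)
    fix i j assume "(i, j) \<in> X_vars n m" and ij: "i \<le> j"
    then obtain k where k: "i = Suc k" "k < n" "j \<le> m"
      by (cases i) (auto simp: X_vars_def)
    let ?bs = "[1..<Suc k]"
    have bs: "column_entries n m ?bs" "column_entries n m (?bs @ [j])"
      using k ij nm by (auto simp: column_entries_def sorted_wrt_append simp del: upt_Suc)
    have "1 = (\<Prod>l<length (?bs @ [j]). \<alpha> (Suc l, (?bs @ [j]) ! l))"
      using prod[OF bs(2)] by (rule sym)
    also have "\<dots> = (\<Prod>l<k. \<alpha> (Suc l, (?bs @ [j]) ! l)) * \<alpha> (Suc k, j)"
      by (simp add: nth_append del: upt_Suc)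
    also have "(\<Prod>l<k. \<alpha> (Suc l, (?bs @ [j]) ! l)) = (\<Prod>l<length ?bs. \<alpha> (Suc l, ?bs ! l))"
      by (intro prod.cong) (simp_all add: nth_append del: upt_Suc)
    also have "\<dots> = 1" by (rule prod[OF bs(1)])
    finally show "\<alpha> (i, j) = 1" using k by simp
  qed
next
  assume one: "\<forall>(i, j)\<in>X_vars n m. i \<le> j \<longrightarrow> \<alpha> (i, j) = 1"
  show "\<Psi> n m \<alpha> = (\<lambda>T\<in>G_cols n m. 1)"
    unfolding \<Psi>_eq
  proof (rule restrict_ext)
    fix T assume "T \<in> G_cols n m"
    then obtain as where as: "column_entries n m as" "T = column as" by (rule G_colsE)
    have "\<alpha> (Suc i, as ! i) = 1" if "i < length as" for i
    proof -
      have "as ! i \<in> {1..m}" "length as \<le> n"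
        using as(1) nth_mem[OF that] unfolding column_entries_def by blast+
      then have "(Suc i, as ! i) \<in> X_vars n m"
        using that by (simp add: X_vars_def)
      then show ?thesis using one column_entries_nth_ge[OF as(1) that] by blast
    qed
    then show "tableau_char n m \<alpha> T = 1" by (simp add: as tableau_char_column)
  qed
qed

lemma \<Psi>_mult:
  "\<Psi> n m (\<lambda>p\<in>X_vars n m. \<alpha> p * \<beta> p) = (\<lambda>T\<in>G_cols n m. \<Psi> n m \<alpha> T * \<Psi> n m \<beta> T)"
  unfolding \<Psi>_eq
  by (rule restrict_ext)
     (auto simp: tableau_char_def power_mult_distrib simp flip: prod.distrib intro!: prod.cong)

lemma \<Psi>_one: "\<Psi> n m (\<lambda>p\<in>X_vars n m. 1) = (\<lambda>T\<in>G_cols n m. 1)"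
  unfolding \<Psi>_eq
  by (rule restrict_ext) (auto simp: tableau_char_def intro!: prod.neutral)

section \<open>The three groups\<close>

lemma inj_on_ev: "inj_on (ev n m) (I_pts n m :: (nat \<times> nat \<Rightarrow> 'k::field) set)"
proof (rule inj_onI)
  fix \<alpha> \<beta> :: "nat \<times> nat \<Rightarrow> 'k"
  assume I: "\<alpha> \<in> I_pts n m" "\<beta> \<in> I_pts n m" and eq: "ev n m \<alpha> = ev n m \<beta>"
  show "\<alpha> = \<beta>"
  proof (rule extensionalityI)
    show "\<alpha> \<in> extensional (X_vars n m)" "\<beta> \<in> extensional (X_vars n m)"
      using I by (auto simp: I_pts_def PiE_def)
    show "\<alpha> p = \<beta> p" if "p \<in> X_vars n m" for p
      using poly_eval_var[OF that] eq by (metis ev_def)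
  qed
qed

lemma I_pts_families:
  "entrywise_families (X_vars n m) (I_pts n m :: (nat \<times> nat \<Rightarrow> 'k::field) set) (ev n m)"
  by standard (use inj_on_ev in \<open>auto simp: I_pts_def PiE_def\<close>)

text \<open>The points are recovered as the values of the quotient maps at the columns.  This relies on
  every point being of the form \<open>\<Psi>(\<alpha>)\<close>: only then is the quotient known to be the field.\<close>

lemma inj_on_quot_map:
  assumes nm: "1 \<le> n" "n \<le> m"
  shows "inj_on (quot_map n m) (J_pts n m :: (tableau \<Rightarrow> 'k::field) set)"
proof (rule inj_onI)
  fix s t :: "tableau \<Rightarrow> 'k"
  assume J: "s \<in> J_pts n m" "t \<in> J_pts n m" and eq: "quot_map n m s = quot_map n m t"
  have embed: "quot_map n m u (embed T) = u T" if "u \<in> J_pts n m" "T \<in> G_cols n m"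
    for u :: "tableau \<Rightarrow> 'k" and T
    using that quot_map_\<Psi>_embed[OF that(2)] by (auto simp: J_pts_eq_image[OF nm])
  show "s = t"
  proof (rule extensionalityI)
    show "s \<in> extensional (G_cols n m)" "t \<in> extensional (G_cols n m)"
      using J by (simp_all add: J_pts_def points_iff[OF nm])
    show "s T = t T" if "T \<in> G_cols n m" for T
      using embed[OF J(1) that] embed[OF J(2) that] eq by simp
  qed
qed

text \<open>Closure under inverses comes from the shape of the relations: both sides are monomials, so
  they survive inverting all values.\<close>

lemma J_pts_families:
  fixes \<phi> :: "(tableau \<Rightarrow> 'k::field) \<Rightarrow> 'b"
  assumes nm: "1 \<le> n" "n \<le> m" and inj: "inj_on \<phi> (J_pts n m)"
  shows "entrywise_families (G_cols n m) (J_pts n m) \<phi>"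
proof
  interpret I: entrywise_families "X_vars n m" "I_pts n m :: (nat \<times> nat \<Rightarrow> 'k) set" "ev n m"
    by (rule I_pts_families)
  show "(J_pts n m :: (tableau \<Rightarrow> 'k) set) \<subseteq> extensional (G_cols n m)"
    by (auto simp: J_pts_def points_iff[OF nm])
  show "a T \<noteq> 0" if "a \<in> J_pts n m" "T \<in> G_cols n m"
    for a :: "tableau \<Rightarrow> 'k" and T
    using that by (simp add: J_pts_def)
  show "(\<lambda>T\<in>G_cols n m. 1 :: 'k) \<in> J_pts n m"
    unfolding J_pts_eq_image[OF nm] \<Psi>_one[symmetric] by (rule imageI) (rule I.one_mem)
  show "(\<lambda>T\<in>G_cols n m. a T * b T) \<in> J_pts n m" if "a \<in> J_pts n m" "b \<in> J_pts n m"
    for a b :: "tableau \<Rightarrow> 'k"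
    using that unfolding J_pts_eq_image[OF nm]
    by (auto simp: I.mult_mem simp flip: \<Psi>_mult)
  show "(\<lambda>T\<in>G_cols n m. inverse (a T)) \<in> J_pts n m" if "a \<in> J_pts n m" for a :: "tableau \<Rightarrow> 'k"
  proof -
    have a: "a \<in> points n m" "\<forall>T\<in>G_cols n m. a T \<noteq> 0" using that by (simp_all add: J_pts_def)
    have "inverse (a b) * inverse (a c) = inverse (a d) * inverse (a e)"
      if "{b, c, d, e} \<subseteq> G_cols n m" "distinct [b, c, d, e]" "b + c = d + e" for b c d e
      using a(1) that unfolding points_iff[OF nm] by (metis inverse_mult_distrib)
    then show ?thesis
      using a(2) by (simp add: J_pts_def points_iff[OF nm])
  qed
  show "inj_on \<phi> (J_pts n m)" by fact
qed

lemma inj_on_M_ideal: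
  assumes nm: "1 \<le> n" "n \<le> m"
  shows "inj_on (M_ideal n m) (J_pts n m :: (tableau \<Rightarrow> 'k::field) set)"
proof (rule inj_onI)
  fix s t :: "tableau \<Rightarrow> 'k"
  assume J: "s \<in> J_pts n m" "t \<in> J_pts n m" and eq: "M_ideal n m s = M_ideal n m t"
  have "quot_map n m s = quot_map n m t" unfolding quot_map_def eq ..
  then show "s = t" using inj_onD[OF inj_on_quot_map[OF nm]] J by blast
qed

theorem theorem3p13:
  fixes n m :: nat
    and Ev :: "((nat \<times> nat, 'k::{alg_closed_field, field_char_0}) polynomial \<Rightarrow> 'k) monoid"
    and Pr :: "('k tableaux_algebra \<Rightarrow> 'k) monoid"
    and Mord :: "'k tableaux_algebra set monoid"
  defines "Ev \<equiv> Ev0 n m" and "Pr \<equiv> Pr0 n m" and "Mord \<equiv> M_ord n m"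
  assumes "1 \<le> n" and "n \<le> m"
  shows "(\<forall>\<alpha>\<in>I_pts n m. \<Psi>0 n m (ev n m \<alpha>) = (quot_map n m (\<Psi> n m \<alpha>) :: 'k tableaux_algebra \<Rightarrow> 'k)) \<and>
    group_hom Ev Pr (\<Psi>0 n m) \<and>
    \<Psi>0 n m ` carrier Ev = carrier Pr \<and>
    kernel Ev Pr (\<Psi>0 n m) =
      {ev n m \<alpha> | \<alpha>. \<alpha> \<in> I_pts n m \<and> (\<forall>(i, j)\<in>X_vars n m. i \<le> j \<longrightarrow> \<alpha> (i, j) = 1)} \<and>
    group Mord \<and>
    Mord \<cong> Ev Mod kernel Ev Pr (\<Psi>0 n m)"
proof -
  note nm = \<open>1 \<le> n\<close> \<open>n \<le> m\<close>
  interpret I: entrywise_families "X_vars n m" "I_pts n m :: (nat \<times> nat \<Rightarrow> 'k) set" "ev n m"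
    by (rule I_pts_families)
  interpret J: entrywise_families "G_cols n m" "J_pts n m :: (tableau \<Rightarrow> 'k) set" "quot_map n m"
    by (rule J_pts_families[OF nm inj_on_quot_map[OF nm]])
  interpret M: entrywise_families "G_cols n m" "J_pts n m :: (tableau \<Rightarrow> 'k) set" "M_ideal n m"
    by (rule J_pts_families[OF nm inj_on_M_ideal[OF nm]])
  have carrier: "carrier Ev = ev n m ` I_pts n m" "carrier Pr = quot_map n m ` J_pts n m"
    and one: "\<one>\<^bsub>Pr\<^esub> = quot_map n m (\<lambda>T\<in>G_cols n m. 1)"
    by (simp_all add: Ev_def Ev0_def Pr_def Pr0_def entrywise_group_def)
  have group: "group Ev" "group Pr" "group Mord"
    unfolding Ev_def Ev0_def Pr_def Pr0_def Mord_def M_ord_def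
    by (rule I.group_entrywise_group J.group_entrywise_group M.group_entrywise_group)+
  have \<Psi>_J: "\<Psi> n m \<alpha> \<in> J_pts n m" if "\<alpha> \<in> I_pts n m" for \<alpha> :: "nat \<times> nat \<Rightarrow> 'k"
    using nm that by (rule \<Psi>_mem_J_pts)
  have \<Psi>0: "\<Psi>0 n m (ev n m \<alpha>) = quot_map n m (\<Psi> n m \<alpha>)"
    if "\<alpha> \<in> I_pts n m" for \<alpha> :: "nat \<times> nat \<Rightarrow> 'k"
    unfolding \<Psi>0_def by (rule the_equality) (use that I.inj in \<open>auto dest: inj_onD\<close>)
  have hom: "group_hom Ev Pr (\<Psi>0 n m)"
  proof (intro group_hom.intro group_hom_axioms.intro homI group)
    show "\<Psi>0 n m x \<in> carrier Pr" if "x \<in> carrier Ev" for x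
      using that by (auto simp: carrier \<Psi>0 \<Psi>_J)
    show "\<Psi>0 n m (x \<otimes>\<^bsub>Ev\<^esub> y) = \<Psi>0 n m x \<otimes>\<^bsub>Pr\<^esub> \<Psi>0 n m y"
      if xy: "x \<in> carrier Ev" "y \<in> carrier Ev" for x y
    proof -
      obtain \<alpha> \<beta> where ab: "\<alpha> \<in> I_pts n m" "x = ev n m \<alpha>" "\<beta> \<in> I_pts n m" "y = ev n m \<beta>"
        using xy by (auto simp: carrier)
      have "x \<otimes>\<^bsub>Ev\<^esub> y = ev n m (\<lambda>p\<in>X_vars n m. \<alpha> p * \<beta> p)"
        using ab by (simp only: Ev_def Ev0_def I.mult_entrywise_group)
      moreover have "quot_map n m (\<Psi> n m \<alpha>) \<otimes>\<^bsub>Pr\<^esub> quot_map n m (\<Psi> n m \<beta>) =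
          quot_map n m (\<Psi> n m (\<lambda>p\<in>X_vars n m. \<alpha> p * \<beta> p))"
        using ab by (simp only: Pr_def Pr0_def J.mult_entrywise_group \<Psi>_J \<Psi>_mult)
      ultimately show ?thesis
        using ab I.mult_mem by (simp only: \<Psi>0)
    qed
  qed
  have image: "\<Psi>0 n m ` carrier Ev = carrier Pr"
    unfolding carrier J_pts_eq_image[OF nm] image_image by (rule image_cong) (simp_all add: \<Psi>0)
  have "quot_map n m (\<Psi> n m \<alpha>) = \<one>\<^bsub>Pr\<^esub> \<longleftrightarrow> (\<forall>(i, j)\<in>X_vars n m. i \<le> j \<longrightarrow> \<alpha> (i, j) = 1)"
    if "\<alpha> \<in> I_pts n m" for \<alpha> :: "nat \<times> nat \<Rightarrow> 'k"
    unfolding one inj_on_eq_iff[OF J.inj \<Psi>_J[OF that] J.one_mem] by (rule \<Psi>_eq_one_iff[OF nm])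
  then have kernel: "kernel Ev Pr (\<Psi>0 n m) =
      {ev n m \<alpha> | \<alpha>. \<alpha> \<in> I_pts n m \<and> (\<forall>(i, j)\<in>X_vars n m. i \<le> j \<longrightarrow> \<alpha> (i, j) = 1)}"
    unfolding kernel_def carrier using \<Psi>0 by fastforce
  have "Mord \<cong> Pr"
    unfolding Mord_def M_ord_def Pr_def Pr0_def
    by (rule iso_entrywise_group) (rule M.entrywise_families_axioms J.entrywise_families_axioms)+
  moreover have "Pr \<cong> Ev Mod kernel Ev Pr (\<Psi>0 n m)"
    by (rule group.iso_sym[OF normal.factorgroup_is_group[OF group_hom.normal_kernel[OF hom]]])
       (rule group_hom.FactGroup_iso[OF hom image])
  ultimately have "Mord \<cong> Ev Mod kernel Ev Pr (\<Psi>0 n m)"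
    by (rule iso_trans)
  with \<Psi>0 hom image kernel group(3) show ?thesis by blast
qed

end
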